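(* Let $(M,g)$ be a smooth Riemannian manifold of dimension $m$ with Levi-Civita connection $\nabla$, and let $\mathcal{D}\subseteq TM$ be a regular distribution of rank $n$. \begin{enumerate} \item Given $X_1,X_2,X_3\in\Gamma(\mathcal{D})$, we have $$\mathbf{R}^{\mathcal{D}}(X_1,X_2)X_3=\pi^{\mathcal{D}}(\mathbf{R}(X_1,X_2)X_3)-(\pi^{\mathcal{D}}\circ\nabla_{X_1})(B(X_2,X_3))+(\pi^{\mathcal{D}}\circ\nabla_{X_2})(B(X_1,X_3))+\pi^{\mathcal{D}}\big(\nabla_{[X_1,X_2]^{\mathcal{D}^{\bot}}}X_3\big).$$ \item If $Z_j$, $j=1,\ldots,m-n$, is a local orthonormal basis of $\Gamma(\mathcal{D}^{\bot})$, then $$\mathbf{R}^{\mathcal{D}}(X_1,X_2)X_3=\pi^{\mathcal{D}}(\mathbf{R}(X_1,X_2)X_3)-\sum_{j}B_{Z_j}(X_1,X_3)\,\pi^{\mathcal{D}}(\nabla_{X_2}Z_j)+\sum_{j}B_{Z_j}(X_2,X_3)\,\pi^{\mathcal{D}}(\nabla_{X_1}Z_j)+\pi^{\mathcal{D}}\big(\nabla_{[X_1,X_2]^{\mathcal{D}^{\bot}}}X_3\big),$$ where $[X_1,X_2]^{\mathcal{D}^{\bot}}=\pi^{\mathcal{D}^{\bot}}([X_1,X_2])$. \end{enumerate}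
   Context: All objects are $\mathcal{C}^\infty$. A regular distribution is a smooth subbundle of $TM$ of constant rank; $\mathcal{D}^{\bot}$ is the $g$-orthogonal complement of $\mathcal{D}$; $\Gamma(\cdot)$ denotes smooth sections; $\pi^{\mathcal{D}},\pi^{\mathcal{D}^{\bot}}$ are the orthogonal projections of $TM$ onto $\mathcal{D}$ and $\mathcal{D}^{\bot}$. For $X,Y\in\Gamma(\mathcal{D})$: $\nabla^{\mathcal{D}}_XY=\pi^{\mathcal{D}}(\nabla_XY)$ (intrinsic connection), $[X,Y]^{\mathcal{D}}=\pi^{\mathcal{D}}([X,Y])$, $[X,Y]^{\mathcal{D}^{\bot}}=\pi^{\mathcal{D}^{\bot}}([X,Y])$, $B(X,Y)=\nabla_XY-\nabla^{\mathcal{D}}_XY=\pi^{\mathcal{D}^{\bot}}(\nabla_XY)$ (second fundamental form), and $B_Z(X,Y)=g(B(X,Y),Z)$ for $Z\in\Gamma(\mathcal{D}^{\bot})$. The curvature endomorphisms are, for $X_1,X_2,X_3\in\Gamma(\mathcal{D})$, $$\mathbf{R}(X_1,X_2)X_3=\nabla_{X_1}\nabla_{X_2}X_3-\nabla_{X_2}\nabla_{X_1}X_3-\nabla_{[X_1,X_2]}X_3,$$ $$\mathbf{R}^{\mathcal{D}}(X_1,X_2)X_3=\nabla^{\mathcal{D}}_{X_1}\nabla^{\mathcal{D}}_{X_2}X_3-\nabla^{\mathcal{D}}_{X_2}\nabla^{\mathcal{D}}_{X_1}X_3-\nabla^{\mathcal{D}}_{[X_1,X_2]^{\mathcal{D}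}}X_3.$$
   Formalization: In item 2 the signs of the two sums are exchanged (plus for B_{Z_j}(X_1,X_3), minus for B_{Z_j}(X_2,X_3)), since the printed signs contradict item 1 and fail for tangent planes of concentric spheres in R^3 minus 0; m is at least 1. *)

theory Defs
  imports "HOL-Analysis.Analysis"
begin

section \<open>Smooth maps between Euclidean spaces\<close>

text \<open>The set \<open>S\<close> is always open in what follows. On an open set, being \<open>k + 1\<close> times continuously
  differentiable means being differentiable with all directional derivatives \<open>k\<close> times
  continuously differentiable.\<close>

primrec C_k_on :: "nat \<Rightarrow> 'e set \<Rightarrow> ('e::euclidean_space \<Rightarrow> 'f::euclidean_space) \<Rightarrow> bool" where
  "C_k_on 0 S f \<longleftrightarrow> continuous_on S f"
| "C_k_on (Suc k) S f \<longleftrightarrow>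
     (\<forall>x\<in>S. f differentiable (at x)) \<and> (\<forall>v. C_k_on k S (\<lambda>x. frechet_derivative f (at x) v))"

definition C_infinity_on :: "'e set \<Rightarrow> ('e::euclidean_space \<Rightarrow> 'f::euclidean_space) \<Rightarrow> bool" where
  "C_infinity_on S f \<longleftrightarrow> (\<forall>k. C_k_on k S f)"


section \<open>Smooth manifolds\<close>

text \<open>A manifold is a type \<open>'a\<close> with a Hausdorff second countable topology (these are type class
  constraints) together with a smooth atlas; its dimension is \<open>CARD('m)\<close>. A chart is a pair of its
  domain and its coordinate map; the values of the coordinate map outside the domain are irrelevant.\<close>

type_synonym ('a, 'm) chart = "'a set \<times> ('a \<Rightarrow> real ^ 'm)"

abbreviation chart_inv :: "('a, 'm::finite) chart \<Rightarrow> real ^ 'm \<Rightarrow> 'a" where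
  "chart_inv c \<equiv> inv_into (fst c) (snd c)"

definition smooth_atlas :: "('a::{t2_space, second_countable_topology}, 'm::finite) chart set \<Rightarrow> bool"
  where
  "smooth_atlas A \<longleftrightarrow>
     (\<Union>c\<in>A. fst c) = UNIV \<and>
     (\<forall>c\<in>A. open (fst c) \<and> open (snd c ` fst c) \<and>
        homeomorphism (fst c) (snd c ` fst c) (snd c) (chart_inv c)) \<and>
     (\<forall>c\<in>A. \<forall>d\<in>A. C_infinity_on (snd c ` (fst c \<inter> fst d)) (snd d \<circ> chart_inv c))"

definition smooth_functions ::
  "('a::{t2_space, second_countable_topology}, 'm::finite) chart set \<Rightarrow> 'a set \<Rightarrow> ('a \<Rightarrow> real) set"
  where
  "smooth_functions A U =
     {f. \<forall>c\<in>A. C_infinity_on (snd c ` (U \<inter> fst c)) (f \<circ> chart_inv c)}"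


section \<open>Tangent vectors and vector fields\<close>

text \<open>One chart around each point \<open>p\<close> is selected, and a tangent vector at \<open>p\<close> is represented by its
  components in that chart, so that every tangent space is a copy of \<open>real ^ 'm\<close>. The components of
  a tangent vector in an arbitrary chart around \<open>p\<close> are obtained by applying the derivative of the
  transition map. No continuity in \<open>p\<close> of the selection is assumed: smoothness of a vector field
  always refers to its components in a fixed chart.\<close>

type_synonym ('a, 'm) vector_field = "'a \<Rightarrow> real ^ 'm"

definition chart_at :: "('a, 'm) chart set \<Rightarrow> 'a \<Rightarrow> ('a, 'm) chart" where
  "chart_at A p = (SOME c. c \<in> A \<and> p \<in> fst c)"

definition components ::
  "('a, 'm::finite) chart set \<Rightarrow> ('a, 'm) chart \<Rightarrow> 'a \<Rightarrow> real ^ 'm \<Rightarrow> real ^ 'm" where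
  "components A c p v =
     frechet_derivative (snd c \<circ> chart_inv (chart_at A p)) (at (snd (chart_at A p) p)) v"

definition vector_fields ::
  "('a::{t2_space, second_countable_topology}, 'm::finite) chart set \<Rightarrow> 'a set \<Rightarrow>
     ('a, 'm) vector_field set" where
  "vector_fields A U =
     {X. \<forall>c\<in>A. C_infinity_on (snd c ` (U \<inter> fst c)) ((\<lambda>p. components A c p (X p)) \<circ> chart_inv c)}"

definition dir_deriv ::
  "('a, 'm::finite) chart set \<Rightarrow> ('a, 'm) vector_field \<Rightarrow> ('a \<Rightarrow> real) \<Rightarrow> 'a \<Rightarrow> real" where
  "dir_deriv A X f p =
     frechet_derivative (f \<circ> chart_inv (chart_at A p)) (at (snd (chart_at A p) p)) (X p)"

definition lie_bracket ::
  "('a::{t2_space, second_countable_topology}, 'm::finite) chart set \<Rightarrow>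
     ('a, 'm) vector_field \<Rightarrow> ('a, 'm) vector_field \<Rightarrow> ('a, 'm) vector_field" where
  "lie_bracket A X Y p =
     (THE v. \<forall>f\<in>smooth_functions A UNIV.
        dir_deriv A (\<lambda>_. v) f p =
          dir_deriv A X (dir_deriv A Y f) p - dir_deriv A Y (dir_deriv A X f) p)"


section \<open>Riemannian metrics and the Levi-Civita connection\<close>

type_synonym ('a, 'm) metric = "'a \<Rightarrow> real ^ 'm \<Rightarrow> real ^ 'm \<Rightarrow> real"

definition riemannian_metric ::
  "('a::{t2_space, second_countable_topology}, 'm::finite) chart set \<Rightarrow> ('a, 'm) metric \<Rightarrow> bool" where
  "riemannian_metric A g \<longleftrightarrow>
     (\<forall>p. bilinear (g p) \<and> (\<forall>v w. g p v w = g p w v) \<and> (\<forall>v. v \<noteq> 0 \<longrightarrow> g p v v > 0)) \<and>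
     (\<forall>U. open U \<longrightarrow> (\<forall>X\<in>vector_fields A U. \<forall>Y\<in>vector_fields A U.
        (\<lambda>p. g p (X p) (Y p)) \<in> smooth_functions A U))"

type_synonym ('a, 'm) connection =
  "('a, 'm) vector_field \<Rightarrow> ('a, 'm) vector_field \<Rightarrow> ('a, 'm) vector_field"

definition affine_connection ::
  "('a::{t2_space, second_countable_topology}, 'm::finite) chart set \<Rightarrow> ('a, 'm) connection \<Rightarrow> bool"
  where
  "affine_connection A nabla \<longleftrightarrow>
     (\<forall>X\<in>vector_fields A UNIV. \<forall>Y\<in>vector_fields A UNIV. nabla X Y \<in> vector_fields A UNIV) \<and>
     (\<forall>X\<in>vector_fields A UNIV. \<forall>X'\<in>vector_fields A UNIV. \<forall>Y\<in>vector_fields A UNIV.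
        nabla (\<lambda>p. X p + X' p) Y = (\<lambda>p. nabla X Y p + nabla X' Y p)) \<and>
     (\<forall>f\<in>smooth_functions A UNIV. \<forall>X\<in>vector_fields A UNIV. \<forall>Y\<in>vector_fields A UNIV.
        nabla (\<lambda>p. f p *\<^sub>R X p) Y = (\<lambda>p. f p *\<^sub>R nabla X Y p)) \<and>
     (\<forall>X\<in>vector_fields A UNIV. \<forall>Y\<in>vector_fields A UNIV. \<forall>Y'\<in>vector_fields A UNIV.
        nabla X (\<lambda>p. Y p + Y' p) = (\<lambda>p. nabla X Y p + nabla X Y' p)) \<and>
     (\<forall>f\<in>smooth_functions A UNIV. \<forall>X\<in>vector_fields A UNIV. \<forall>Y\<in>vector_fields A UNIV.
        nabla X (\<lambda>p. f p *\<^sub>R Y p) = (\<lambda>p. f p *\<^sub>R nabla X Y p + dir_deriv A X f p *\<^sub>R Y p))"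

definition levi_civita ::
  "('a::{t2_space, second_countable_topology}, 'm::finite) chart set \<Rightarrow> ('a, 'm) metric \<Rightarrow>
     ('a, 'm) connection \<Rightarrow> bool" where
  "levi_civita A g nabla \<longleftrightarrow>
     affine_connection A nabla \<and>
     (\<forall>X\<in>vector_fields A UNIV. \<forall>Y\<in>vector_fields A UNIV.
        (\<lambda>p. nabla X Y p - nabla Y X p) = lie_bracket A X Y) \<and>
     (\<forall>X\<in>vector_fields A UNIV. \<forall>Y\<in>vector_fields A UNIV. \<forall>Z\<in>vector_fields A UNIV.
        dir_deriv A X (\<lambda>p. g p (Y p) (Z p)) =
          (\<lambda>p. g p (nabla X Y p) (Z p) + g p (Y p) (nabla X Z p)))"

text \<open>The connection applied to a field \<open>Z\<close> that is only smooth near \<open>p\<close>. A connection is a local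
  operator, so the value at \<open>p\<close> is that of any global smooth field which agrees with \<open>Z\<close> near \<open>p\<close>.\<close>

definition local_nabla ::
  "('a::{t2_space, second_countable_topology}, 'm::finite) chart set \<Rightarrow> ('a, 'm) connection \<Rightarrow>
     ('a, 'm) connection" where
  "local_nabla A nabla X Z p =
     nabla X (SOME W. W \<in> vector_fields A UNIV \<and> (\<forall>\<^sub>F q in nhds p. W q = Z q)) p"

definition curvature ::
  "('a::{t2_space, second_countable_topology}, 'm::finite) chart set \<Rightarrow> ('a, 'm) connection \<Rightarrow>
     ('a, 'm) vector_field \<Rightarrow> ('a, 'm) vector_field \<Rightarrow> ('a, 'm) vector_field \<Rightarrow>
     ('a, 'm) vector_field" where
  "curvature A nabla X\<^sub>1 X\<^sub>2 X\<^sub>3 p =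
     nabla X\<^sub>1 (nabla X\<^sub>2 X\<^sub>3) p - nabla X\<^sub>2 (nabla X\<^sub>1 X\<^sub>3) p - nabla (lie_bracket A X\<^sub>1 X\<^sub>2) X\<^sub>3 p"


section \<open>Distributions\<close>

type_synonym ('a, 'm) distribution = "'a \<Rightarrow> (real ^ 'm) set"

definition sections ::
  "('a::{t2_space, second_countable_topology}, 'm::finite) chart set \<Rightarrow> ('a, 'm) distribution \<Rightarrow>
     'a set \<Rightarrow> ('a, 'm) vector_field set" where
  "sections A D U = {X \<in> vector_fields A U. \<forall>p\<in>U. X p \<in> D p}"

definition regular_distribution ::
  "('a::{t2_space, second_countable_topology}, 'm::finite) chart set \<Rightarrow> nat \<Rightarrow>
     ('a, 'm) distribution \<Rightarrow> bool" where
  "regular_distribution A n D \<longleftrightarrow>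
     (\<forall>p. subspace (D p) \<and> dim (D p) = n) \<and>
     (\<forall>p. \<exists>U E. open U \<and> p \<in> U \<and>
        (\<forall>i<n. E i \<in> sections A D U) \<and> (\<forall>q\<in>U. span ((\<lambda>i. E i q) ` {..<n}) = D q))"

definition orth_compl :: "('a, 'm::finite) metric \<Rightarrow> ('a, 'm) distribution \<Rightarrow> ('a, 'm) distribution"
  where
  "orth_compl g D p = {v. \<forall>w\<in>D p. g p v w = 0}"

definition orth_proj ::
  "('a, 'm::finite) metric \<Rightarrow> ('a, 'm) distribution \<Rightarrow> ('a, 'm) vector_field \<Rightarrow>
     ('a, 'm) vector_field" where
  "orth_proj g D X p = (THE v. v \<in> D p \<and> X p - v \<in> orth_compl g D p)"

definition intrinsic_connection ::
  "('a, 'm::finite) metric \<Rightarrow> ('a, 'm) connection \<Rightarrow> ('a, 'm) distribution \<Rightarrow> ('a, 'm) connection"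
  where
  "intrinsic_connection g nabla D X Y = orth_proj g D (nabla X Y)"

definition second_fund_form ::
  "('a, 'm::finite) metric \<Rightarrow> ('a, 'm) connection \<Rightarrow> ('a, 'm) distribution \<Rightarrow>
     ('a, 'm) vector_field \<Rightarrow> ('a, 'm) vector_field \<Rightarrow> ('a, 'm) vector_field" where
  "second_fund_form g nabla D X Y p = nabla X Y p - intrinsic_connection g nabla D X Y p"

text \<open>Sign convention: the normal component of the derivative itself is paired with \<open>Z\<close>. For sections
  \<open>X\<close>, \<open>Y\<close> of \<open>D\<close> and \<open>Z\<close> of the orthogonal complement, metric compatibility makes the scalar form
  along \<open>Z\<close> equal to minus the inner product of \<open>Y\<close> with the derivative of \<open>Z\<close> in direction \<open>X\<close>. With
  the curvature conventions used here, the terms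
  \<open>B\<^bsub>Z\<^esub>(X\<^sub>2, X\<^sub>3) \<pi>\<^bsup>D\<^esup>(\<nabla>\<^bsub>X\<^sub>1\<^esub> Z)\<close> of the Gauss equation therefore occur with a minus sign, those with
  \<open>X\<^sub>1\<close> and \<open>X\<^sub>2\<close> exchanged with a plus sign; the opposite signs, which one may find in print, give
  curvature \<open>-1\<close> for the unit sphere.\<close>

definition second_fund_form_along ::
  "('a, 'm::finite) metric \<Rightarrow> ('a, 'm) connection \<Rightarrow> ('a, 'm) distribution \<Rightarrow>
     ('a, 'm) vector_field \<Rightarrow> ('a, 'm) vector_field \<Rightarrow> ('a, 'm) vector_field \<Rightarrow> 'a \<Rightarrow> real" where
  "second_fund_form_along g nabla D Z X Y p = g p (second_fund_form g nabla D X Y p) (Z p)"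

definition intrinsic_curvature ::
  "('a::{t2_space, second_countable_topology}, 'm::finite) chart set \<Rightarrow> ('a, 'm) metric \<Rightarrow>
     ('a, 'm) connection \<Rightarrow> ('a, 'm) distribution \<Rightarrow>
     ('a, 'm) vector_field \<Rightarrow> ('a, 'm) vector_field \<Rightarrow> ('a, 'm) vector_field \<Rightarrow>
     ('a, 'm) vector_field" where
  "intrinsic_curvature A g nabla D X\<^sub>1 X\<^sub>2 X\<^sub>3 p =
     intrinsic_connection g nabla D X\<^sub>1 (intrinsic_connection g nabla D X\<^sub>2 X\<^sub>3) p
     - intrinsic_connection g nabla D X\<^sub>2 (intrinsic_connection g nabla D X\<^sub>1 X\<^sub>3) p
     - intrinsic_connection g nabla D (orth_proj g D (lie_bracket A X\<^sub>1 X\<^sub>2)) X\<^sub>3 p"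

definition local_orthonormal_basis ::
  "('a::{t2_space, second_countable_topology}, 'm::finite) chart set \<Rightarrow> ('a, 'm) metric \<Rightarrow>
     ('a, 'm) distribution \<Rightarrow> 'a set \<Rightarrow> nat \<Rightarrow> (nat \<Rightarrow> ('a, 'm) vector_field) \<Rightarrow> bool" where
  "local_orthonormal_basis A g E U k Z \<longleftrightarrow>
     (\<forall>j\<in>{1..k}. Z j \<in> sections A E U) \<and>
     (\<forall>p\<in>U. \<forall>i\<in>{1..k}. \<forall>j\<in>{1..k}. g p (Z i p) (Z j p) = (if i = j then 1 else 0)) \<and>
     (\<forall>p\<in>U. span ((\<lambda>j. Z j p) ` {1..k}) = E p)"

end

theory Submission
  imports Defs
begin

text \<open>For globally smooth fields the first identity is bookkeeping: split \<open>\<nabla>\<^bsub>Y\<^esub> W\<close> and \<open>[X\<^sub>1, X\<^sub>2]\<close>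
  into tangential and normal parts, use additivity of \<open>\<nabla>\<close> in both arguments, and project. What has to
  be checked is that the parts are smooth, which follows by applying Gram-Schmidt without
  normalisation to a local frame of \<open>D\<close>; the bracket needs no work because torsion-freeness makes
  it a difference of covariant derivatives. For the second identity, expand \<open>B(X, Y)\<close> near \<open>p\<close> in the
  frame \<open>Z\<close>, extend the \<open>Z j\<close> to global fields by means of a bump function, and use that \<open>\<nabla>\<close> is
  local; the derivatives of the coefficients disappear under the projection to \<open>D\<close>.\<close>

section \<open>Calculus of smooth maps\<close>

text \<open>Since \<open>S\<close> is open, the two functions agree near each of its points, so they
  share the derivative there and the induction passes to directional derivatives. Values off
  \<open>S\<close>, such as those of a chart inverse outside the chart range, therefore never
  matter.\<close>

lemma C_k_on_cong:
  assumes "open S" "\<And>x. x \<in> S \<Longrightarrow> f x = g x" "C_k_on k S f"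
  shows "C_k_on k S g"
  using assms(2,3)
proof (induction k arbitrary: f g)
  case 0
  then show ?case by (auto cong: continuous_on_cong)
next
  case (Suc k)
  have f: "(f has_derivative frechet_derivative f (at x)) (at x)" if "x \<in> S" for x
    using Suc.prems(2) that frechet_derivative_works by auto
  have g: "(g has_derivative frechet_derivative f (at x)) (at x)" if "x \<in> S" for x
    by (rule has_derivative_transform_within_open[OF f[OF that] assms(1) that]) (rule Suc.prems(1))
  have "frechet_derivative g (at x) = frechet_derivative f (at x)" if "x \<in> S" for x
    using frechet_derivative_at[OF g[OF that]] by simp
  then have "C_k_on k S (\<lambda>x. frechet_derivative g (at x) v)" for v
    using Suc.IH[of "\<lambda>x. frechet_derivative f (at x) v" "\<lambda>x. frechet_derivative g (at x) v"]
      Suc.prems(2) by simp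
  moreover have "g differentiable (at x)" if "x \<in> S" for x
    using g[OF that] by (rule differentiableI)
  ultimately show ?case by simp
qed

text \<open>Lets any explicit derivative formula \<open>f'\<close> stand in for
  \<open>frechet_derivative\<close>; the closure proofs below feed the sum, product and chain rules
  through it.\<close>

lemma C_k_on_SucI:
  assumes "open S" "\<And>x. x \<in> S \<Longrightarrow> (f has_derivative f' x) (at x)" "\<And>v. C_k_on k S (\<lambda>x. f' x v)"
  shows "C_k_on (Suc k) S f"
proof -
  have "f' x = frechet_derivative f (at x)" if "x \<in> S" for x
    using assms(2)[OF that] frechet_derivative_at by metis
  then have "C_k_on k S (\<lambda>x. frechet_derivative f (at x) v)" for v
    by (intro C_k_on_cong[OF assms(1) _ assms(3)[of v]]) simp
  then show ?thesis
    using assms(2) by (auto simp: differentiable_def)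
qed

lemma C_k_on_Suc_has_derivative:
  "C_k_on (Suc k) S f \<Longrightarrow> x \<in> S \<Longrightarrow> (f has_derivative frechet_derivative f (at x)) (at x)"
  using frechet_derivative_works by auto

lemma C_k_on_SucD: "C_k_on (Suc k) S f \<Longrightarrow> C_k_on k S f"
proof (induction k arbitrary: f)
  case 0
  then show ?case
    by (auto intro!: continuous_at_imp_continuous_on differentiable_imp_continuous_within)
qed auto

lemma C_k_on_const: "C_k_on k S (\<lambda>x. c)"
  by (induction k arbitrary: c) auto

text \<open>A neighbourhood that witnesses order \<open>Suc k\<close> for \<open>f\<close> also
  witnesses order \<open>k\<close> for each directional derivative, so the induction hypothesis
  applies to the derivative.\<close>

lemma C_k_on_local:
  assumes "open S" "\<And>x. x \<in> S \<Longrightarrow> \<exists>T. open T \<and> x \<in> T \<and> C_k_on k T f"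
  shows "C_k_on k S f"
  using assms(2)
proof (induction k arbitrary: f)
  case 0
  then show ?case
    by (metis C_k_on.simps(1) assms(1) continuous_on_eq_continuous_at)
next
  case (Suc k)
  show ?case
    unfolding C_k_on.simps
  proof (intro conjI ballI allI)
    show "f differentiable at x" if "x \<in> S" for x
      using Suc.prems[OF that] by auto
    show "C_k_on k S (\<lambda>x. frechet_derivative f (at x) v)" for v
      by (rule Suc.IH) (use Suc.prems in fastforce)
  qed
qed

lemma C_k_on_add:
  assumes "open S" "C_k_on k S f" "C_k_on k S g"
  shows "C_k_on k S (\<lambda>x. f x + g x)"
  using assms(2,3)
proof (induction k arbitrary: f g)
  case 0
  then show ?case by (auto intro: continuous_intros)
next
  case (Suc k)
  show ?case
    by (rule C_k_on_SucI[OF assms(1)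
            has_derivative_add[OF Suc.prems[THEN C_k_on_Suc_has_derivative]] _])
       (use Suc in auto)
qed

lemma C_k_on_linear:
  assumes "open S" "bounded_linear L" "C_k_on k S f"
  shows "C_k_on k S (\<lambda>x. L (f x))"
  using assms(3)
proof (induction k arbitrary: f)
  case 0
  then show ?case
    using assms(2) by (auto intro: bounded_linear.continuous_on)
next
  case (Suc k)
  show ?case
    by (rule C_k_on_SucI[OF assms(1) bounded_linear.has_derivative[OF assms(2)
            C_k_on_Suc_has_derivative[OF Suc.prems]] _])
       (use Suc in auto)
qed

lemma C_k_on_scaleR:
  assumes "open S" "C_k_on k S f" "C_k_on k S g"
  shows "C_k_on k S (\<lambda>x. f x *\<^sub>R g x)"
  using assms(2,3)
proof (induction k arbitrary: f g)
  case 0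
  then show ?case by (auto intro: continuous_intros)
next
  case (Suc k)
  show ?case
  proof (rule C_k_on_SucI[OF assms(1)
            has_derivative_scaleR[OF Suc.prems[THEN C_k_on_Suc_has_derivative]] _])
    fix v
    show "C_k_on k S (\<lambda>x. f x *\<^sub>R frechet_derivative g (at x) v + frechet_derivative f (at x) v *\<^sub>R g x)"
      using Suc.prems by (intro C_k_on_add[OF assms(1)] Suc.IH) (auto intro: C_k_on_SucD)
  qed
qed

lemma C_k_on_sum:
  assumes "open S" "\<And>i. i \<in> I \<Longrightarrow> C_k_on k S (f i)"
  shows "C_k_on k S (\<lambda>x. \<Sum>i\<in>I. f i x)"
  using assms(2)
  by (induction I rule: infinite_finite_induct)
     (auto intro: C_k_on_const C_k_on_add[OF assms(1)])

text \<open>In the chain rule the derivative of \<open>h\<close> is taken in the moving direction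
  \<open>frechet_derivative f (at x) v\<close>. Expanding that direction in \<open>Basis\<close>
  leaves scalar functions of \<open>x\<close> times derivatives of \<open>h\<close> in fixed
  directions, evaluated at \<open>f x\<close>; the latter are again composites with
  \<open>f\<close>, which is why the induction generalises over \<open>h\<close> only.\<close>

lemma C_k_on_compose:
  fixes f :: "'e::euclidean_space \<Rightarrow> 'f::euclidean_space" and h :: "'f \<Rightarrow> 'g::euclidean_space"
  assumes "open S" "open T" "f ` S \<subseteq> T" "C_k_on k S f" "C_k_on k T h"
  shows "C_k_on k S (\<lambda>x. h (f x))"
  using assms(4,5)
proof (induction k arbitrary: h)
  case 0
  then show ?case using assms(3) by (auto intro: continuous_on_compose2)
next
  case (Suc k)
  note Df = C_k_on_Suc_has_derivative[OF Suc.prems(1)]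
  note Dh = C_k_on_Suc_has_derivative[OF Suc.prems(2)]
  have expand: "(\<Sum>b\<in>Basis. (frechet_derivative f (at x) v \<bullet> b) *\<^sub>R frechet_derivative h (at (f x)) b)
      = frechet_derivative h (at (f x)) (frechet_derivative f (at x) v)" if "x \<in> S" for x v
  proof -
    have "linear (frechet_derivative h (at (f x)))"
      using Dh that assms(3) has_derivative_linear by blast
    then show ?thesis
      by (subst (2) euclidean_representation[symmetric]) (simp add: linear_sum linear_scale)
  qed
  show ?case
  proof (rule C_k_on_SucI[OF assms(1)])
    fix x assume x: "x \<in> S"
    show "((\<lambda>x. h (f x)) has_derivative
        (\<lambda>v. \<Sum>b\<in>Basis. (frechet_derivative f (at x) v \<bullet> b) *\<^sub>R frechet_derivative h (at (f x)) b)) (at x)"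
      unfolding expand[OF x]
      using has_derivative_compose[OF Df[OF x] Dh] assms(3) x by auto
  next
    fix v
    show "C_k_on k S (\<lambda>x. \<Sum>b\<in>Basis.
        (frechet_derivative f (at x) v \<bullet> b) *\<^sub>R frechet_derivative h (at (f x)) b)"
    proof (intro C_k_on_sum C_k_on_scaleR assms(1))
      fix b :: 'f
      show "C_k_on k S (\<lambda>x. frechet_derivative f (at x) v \<bullet> b)"
        using Suc.prems(1) by (intro C_k_on_linear[OF assms(1) bounded_linear_inner_left]) simp
      show "C_k_on k S (\<lambda>x. frechet_derivative h (at (f x)) b)"
        by (rule Suc.IH[of "\<lambda>y. frechet_derivative h (at y) b", OF C_k_on_SucD[OF Suc.prems(1)]])
           (use Suc.prems(2) in \<open>simp only: C_k_on.simps\<close>)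
    qed
  qed
qed

text \<open>The derivative is minus the square of the function itself, so the product rule and the
  induction hypothesis close the step.\<close>

lemma C_k_on_inverse_real: "C_k_on k (- {0}) (inverse :: real \<Rightarrow> real)"
proof (induction k)
  case 0
  then show ?case by (auto intro: continuous_intros)
next
  case (Suc k)
  have op: "open (- {0::real})" by auto
  show ?case
  proof (rule C_k_on_SucI[OF op])
    fix x :: real assume "x \<in> - {0}"
    then show "(inverse has_derivative (\<lambda>v. (- v) *\<^sub>R (inverse x *\<^sub>R inverse x))) (at x)"
      by (auto intro!: derivative_eq_intros)
  qed (intro C_k_on_scaleR op Suc C_k_on_const)
qed

lemma C_k_on_affine:
  assumes "open S" "bounded_linear L"
  shows "C_k_on k S (\<lambda>x. L x + c)"
proof (cases k)
  case 0
  then show ?thesis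
    using linear_continuous_on[OF assms(2)] by (simp add: continuous_on_add)
next
  case (Suc j)
  show ?thesis
    unfolding Suc
    by (rule C_k_on_SucI[OF assms(1) _ C_k_on_const])
       (auto intro!: derivative_eq_intros bounded_linear_imp_has_derivative assms(2))
qed

lemma C_infinity_onD: "C_infinity_on S f \<Longrightarrow> C_k_on k S f"
  by (simp add: C_infinity_on_def)

lemma C_infinity_on_local:
  assumes "open S"
    and "\<And>x. x \<in> S \<Longrightarrow> \<exists>T h. open T \<and> x \<in> T \<and> C_infinity_on T h \<and> (\<forall>y\<in>T. h y = f y)"
  shows "C_infinity_on S f"
  unfolding C_infinity_on_def
proof (intro allI C_k_on_local[OF assms(1)])
  fix k x assume "x \<in> S"
  then obtain T h where T: "open T" "x \<in> T" "C_infinity_on T h" "\<forall>y\<in>T. h y = f y"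
    using assms(2) by blast
  have "C_k_on k T f"
    by (rule C_k_on_cong[OF T(1) _ C_infinity_onD[OF T(3)]]) (use T(4) in simp)
  then show "\<exists>T. open T \<and> x \<in> T \<and> C_k_on k T f"
    using T by blast
qed

lemma C_infinity_on_differentiable: "C_infinity_on S f \<Longrightarrow> x \<in> S \<Longrightarrow> f differentiable (at x)"
  using C_infinity_onD[of S f "Suc 0"] by auto

lemma C_infinity_on_add:
  "open S \<Longrightarrow> C_infinity_on S f \<Longrightarrow> C_infinity_on S g \<Longrightarrow> C_infinity_on S (\<lambda>x. f x + g x)"
  by (simp add: C_infinity_on_def C_k_on_add)

lemma C_infinity_on_scaleR:
  "open S \<Longrightarrow> C_infinity_on S f \<Longrightarrow> C_infinity_on S g \<Longrightarrow> C_infinity_on S (\<lambda>x. f x *\<^sub>R g x)"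
  by (simp add: C_infinity_on_def C_k_on_scaleR)

section \<open>Bump functions\<close>

text \<open>The classical flat function exp(-1/x) is the case \<open>n = 0\<close>. The extra
  negative powers of x make the family closed under differentiation up to linear
  combinations.\<close>

definition flat_exp :: "nat \<Rightarrow> real \<Rightarrow> real" where
  "flat_exp n x = (if x > 0 then inverse x ^ n * exp (- inverse x) else 0)"

text \<open>From the right, substitute t = 1/x: the power t^n loses against exp t as t tends to
  infinity.\<close>

lemma flat_exp_tendsto_0: "(flat_exp n \<longlongrightarrow> 0) (at 0)"
proof -
  have "((\<lambda>x::real. inverse x ^ n / exp (inverse x)) \<longlongrightarrow> 0) (at_right (0::real))"
    using filterlim_compose[OF tendsto_power_div_exp_0 filterlim_inverse_at_top_right] .
  moreover have "\<forall>\<^sub>F x in at_right 0. inverse x ^ n / exp (inverse x) = flat_exp n x"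
    by (auto simp: flat_exp_def eventually_at_filter exp_minus field_simps)
  ultimately have "(flat_exp n \<longlongrightarrow> 0) (at_right 0)"
    by (rule Lim_transform_eventually)
  moreover have "(flat_exp n \<longlongrightarrow> 0) (at_left 0)"
    by (rule Lim_transform_eventually[OF tendsto_const])
       (auto simp: flat_exp_def eventually_at_filter)
  ultimately show ?thesis
    using filterlim_split_at by blast
qed

lemma flat_exp_has_derivative:
  "(flat_exp n has_real_derivative flat_exp (n + 2) x - real n * flat_exp (n + 1) x) (at x)"
proof -
  consider "x > 0" | "x < 0" | "x = 0" by linarith
  then show ?thesis
  proof cases
    case 1
    have "((\<lambda>x. inverse x ^ n) has_real_derivative - real n * inverse x ^ (n + 1)) (at x)"
      by (rule DERIV_cong[OF DERIV_power[OF DERIV_inverse]]) (use 1 in simp, cases n, simp_all add: algebra_simps)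
    from DERIV_mult[OF this DERIV_fun_exp[OF DERIV_minus[OF DERIV_inverse]]]
    have "((\<lambda>x. inverse x ^ n * exp (- inverse x)) has_real_derivative
        flat_exp (n + 2) x - real n * flat_exp (n + 1) x) (at x)"
      using 1 by (auto simp: flat_exp_def algebra_simps elim!: DERIV_cong)
    then show ?thesis
      by (rule has_field_derivative_transform_within_open[of _ _ _ "{0<..}"])
         (use 1 in \<open>auto simp: flat_exp_def\<close>)
  next
    case 2
    have "((\<lambda>x. 0) has_real_derivative 0) (at x)" by simp
    then have "(flat_exp n has_real_derivative 0) (at x)"
      by (rule has_field_derivative_transform_within_open[of _ _ _ "{..<0}"])
         (use 2 in \<open>auto simp: flat_exp_def\<close>)
    then show ?thesis using 2 by (simp add: flat_exp_def)
  next
    case 3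
    \<comment> \<open>The difference quotient at 0 is the next member of the family, whose limit at
      0 is already known.\<close>
    have "(flat_exp n h - flat_exp n 0) / (h - 0) = flat_exp (Suc n) h" for h
      by (auto simp: flat_exp_def field_simps)
    then have "(flat_exp n has_real_derivative 0) (at 0)"
      using flat_exp_tendsto_0[of "Suc n"] by (simp add: has_field_derivative_iff)
    then show ?thesis using 3 by (simp add: flat_exp_def)
  qed
qed

lemma C_k_on_flat_exp: "C_k_on k UNIV (flat_exp n)"
proof (induction k arbitrary: n)
  case 0
  then show ?case
    using DERIV_isCont[OF flat_exp_has_derivative]
    by (auto intro: continuous_at_imp_continuous_on)
next
  case (Suc k)
  show ?case
  proof (rule C_k_on_SucI[OF open_UNIV])
    show "(flat_exp n has_derivative
        (\<lambda>v. v *\<^sub>R (flat_exp (n + 2) x + (- real n) *\<^sub>R flat_exp (n + 1) x))) (at x)" for x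
      using flat_exp_has_derivative[of n x]
      by (rule has_derivative_eq_rhs[OF has_field_derivative_imp_has_derivative])
         (simp add: fun_eq_iff algebra_simps)
    show "C_k_on k UNIV (\<lambda>x. v *\<^sub>R (flat_exp (n + 2) x + (- real n) *\<^sub>R flat_exp (n + 1) x))" for v
      by (intro C_k_on_scaleR C_k_on_add C_k_on_const Suc open_UNIV)
  qed
qed

text \<open>The function is u / (u + u'), where u vanishes for distance at least r and u' vanishes
  for distance at most r/2. The quotient is thus 0 on the first region and 1 on the second, and the
  denominator is positive because u and u' have no common zero.\<close>

lemma smooth_bump:
  fixes y :: "'e::euclidean_space"
  assumes "r > 0"
  obtains f :: "'e \<Rightarrow> real" where "C_infinity_on UNIV f"
    "\<And>x. dist x y \<le> r / 2 \<Longrightarrow> f x = 1" "\<And>x. dist x y \<ge> r \<Longrightarrow> f x = 0"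
proof -
  \<comment> \<open>The squared distance is used because the distance itself is not smooth at
    \<open>y\<close>.\<close>
  define s where "s x = (x - y) \<bullet> (x - y)" for x
  define u where "u t = flat_exp 0 (r\<^sup>2 - t)" for t
  define w where "w t = u t + flat_exp 0 (t - (r/2)\<^sup>2)" for t
  have s: "C_k_on k UNIV s" for k
  \<comment> \<open>Proving order \<open>Suc k\<close> and stepping down avoids a case split on
    \<open>k\<close>. The derivative is written as a linear form in \<open>x\<close> plus a constant
    to fit \<open>C_k_on_affine\<close>.\<close>
  proof (rule C_k_on_SucD, rule C_k_on_SucI[OF open_UNIV])
    show "(s has_derivative (\<lambda>v. (2 *\<^sub>R v) \<bullet> x + (2 *\<^sub>R v) \<bullet> (- y))) (at x)" for x
      unfolding s_def[abs_def]
      by (auto intro!: derivative_eq_intros simp: algebra_simps inner_commute)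
    show "C_k_on k UNIV (\<lambda>x. (2 *\<^sub>R v) \<bullet> x + (2 *\<^sub>R v) \<bullet> (- y))" for v
      by (intro C_k_on_affine open_UNIV bounded_linear_inner_right)
  qed
  have u: "C_k_on k UNIV u" for k
    unfolding u_def
    by (rule C_k_on_compose[OF open_UNIV open_UNIV _ _ C_k_on_flat_exp])
       (use C_k_on_affine[OF open_UNIV, of "\<lambda>t. - t" k "r\<^sup>2"] in \<open>auto simp: bounded_linear_minus bounded_linear_ident\<close>)
  have u': "C_k_on k UNIV (\<lambda>t. flat_exp 0 (t - (r/2)\<^sup>2))" for k
    by (rule C_k_on_compose[OF open_UNIV open_UNIV _ _ C_k_on_flat_exp])
       (use C_k_on_affine[OF open_UNIV, of "\<lambda>t. t" k "- (r/2)\<^sup>2"] in \<open>auto simp: bounded_linear_ident\<close>)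
  have w: "C_k_on k UNIV w" for k
    unfolding w_def by (intro C_k_on_add u u' open_UNIV)
  have flat_pos: "flat_exp 0 x \<ge> 0" "x > 0 \<Longrightarrow> flat_exp 0 x > 0" for x
    by (auto simp: flat_exp_def)
  have "(r/2)\<^sup>2 < r\<^sup>2"
    using assms by (simp add: power2_eq_square)
  then have "r\<^sup>2 - t > 0 \<or> t - (r/2)\<^sup>2 > 0" for t
    by linarith
  then have w_pos: "w t > 0" for t
    unfolding w_def u_def by (meson add_nonneg_pos add_pos_nonneg flat_pos)
  have "C_k_on k UNIV (\<lambda>t. inverse (w t))" for k
  proof (rule C_k_on_compose[OF open_UNIV _ _ w C_k_on_inverse_real])
    show "range w \<subseteq> - {0}"
      using w_pos less_irrefl by (metis ComplI image_subsetI singletonD)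
  qed auto
  then have "C_k_on k UNIV (\<lambda>t. u t *\<^sub>R inverse (w t))" for k
    by (intro C_k_on_scaleR open_UNIV u)
  then have smooth: "C_k_on k UNIV (\<lambda>x. u (s x) *\<^sub>R inverse (w (s x)))" for k
    using C_k_on_compose[OF open_UNIV open_UNIV _ s, of k "\<lambda>t. u t *\<^sub>R inverse (w t)"] by simp
  have s_dist: "s x = (dist x y)\<^sup>2" for x
    by (simp add: s_def dist_norm power2_norm_eq_inner)
  show ?thesis
  proof (rule that[of "\<lambda>x. u (s x) *\<^sub>R inverse (w (s x))"])
    show "C_infinity_on UNIV (\<lambda>x. u (s x) *\<^sub>R inverse (w (s x)))"
      using smooth by (simp add: C_infinity_on_def)
    show "u (s x) *\<^sub>R inverse (w (s x)) = 1" if "dist x y \<le> r / 2" for x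
    proof -
      have "s x \<le> (r/2)\<^sup>2"
        unfolding s_dist using that by (intro power_mono) auto
      then have "w (s x) = u (s x)"
        by (simp add: w_def flat_exp_def)
      then show ?thesis
        using w_pos[of "s x"] by simp
    qed
    show "u (s x) *\<^sub>R inverse (w (s x)) = 0" if "dist x y \<ge> r" for x
    proof -
      have "s x \<ge> r\<^sup>2"
        unfolding s_dist using that assms by (intro power_mono) auto
      then show ?thesis
        by (simp add: u_def flat_exp_def)
    qed
  qed
qed

section \<open>Smooth functions and vector fields on a manifold\<close>

locale smooth_manifold =
  fixes A :: "('a::{t2_space, second_countable_topology}, 'm::finite) chart set"
  assumes atlas: "smooth_atlas A"
begin

section \<open>Charts, tangent components and the locality of smoothness\<close>

lemma chart_homeomorphism: "c \<in> A \<Longrightarrow> homeomorphism (fst c) (snd c ` fst c) (snd c) (chart_inv c)"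
  and open_chart_domain: "c \<in> A \<Longrightarrow> open (fst c)"
  and open_chart_range: "c \<in> A \<Longrightarrow> open (snd c ` fst c)"
  and transition_smooth:
    "c \<in> A \<Longrightarrow> d \<in> A \<Longrightarrow> C_infinity_on (snd c ` (fst c \<inter> fst d)) (snd d \<circ> chart_inv c)"
  using atlas by (auto simp: smooth_atlas_def)

lemma chart_inv_chart: "c \<in> A \<Longrightarrow> p \<in> fst c \<Longrightarrow> chart_inv c (snd c p) = p"
  using homeomorphism_apply1[OF chart_homeomorphism] .

lemma open_chart_image:
  assumes "c \<in> A" "open W"
  shows "open (snd c ` (W \<inter> fst c))"
proof -
  have "openin (top_of_set (fst c)) (W \<inter> fst c)"
    using assms(2) openin_open_Int[of W "fst c"] by (simp add: Int_commute)
  then show ?thesis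
    using homeomorphism_imp_open_map[OF chart_homeomorphism] open_chart_range openin_open_trans assms(1)
    by blast
qed

lemma chart_at: "chart_at A p \<in> A" "p \<in> fst (chart_at A p)"
proof -
  have "\<exists>c. c \<in> A \<and> p \<in> fst c"
    using atlas unfolding smooth_atlas_def by blast
  then show "chart_at A p \<in> A" "p \<in> fst (chart_at A p)"
    unfolding chart_at_def by (metis (mono_tags, lifting) someI_ex)+
qed

text \<open>\<open>frechet_derivative\<close> is known to be linear only at points of
  differentiability; smoothness of the transition map from the selected chart to \<open>c\<close>
  provides this.\<close>

lemma linear_components:
  assumes "c \<in> A" "p \<in> fst c"
  shows "linear (components A c p)"
  unfolding components_def
  by (intro linear_frechet_derivative C_infinity_on_differentiable[OF transition_smooth])
     (use assms chart_at in auto)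

text \<open>Common core of the locality lemmas for functions and for vector fields: \<phi> is the
  function itself in one case and the components of the field in the chart \<open>c\<close> in the
  other.\<close>

lemma smooth_in_chart_local:
  assumes "c \<in> A" "open U"
    and "\<And>p. p \<in> U \<Longrightarrow> p \<in> fst c \<Longrightarrow> \<exists>V \<psi>. open V \<and> p \<in> V \<and>
      C_infinity_on (snd c ` (V \<inter> fst c)) (\<psi> \<circ> chart_inv c) \<and> (\<forall>q\<in>V \<inter> fst c. \<psi> q = \<phi> q)"
  shows "C_infinity_on (snd c ` (U \<inter> fst c)) (\<phi> \<circ> chart_inv c)"
proof (rule C_infinity_on_local[OF open_chart_image[OF assms(1,2)]])
  fix x assume "x \<in> snd c ` (U \<inter> fst c)"
  then obtain p where p: "p \<in> U" "p \<in> fst c" "x = snd c p" by auto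
  then obtain V \<psi> where V: "open V" "p \<in> V"
    "C_infinity_on (snd c ` (V \<inter> fst c)) (\<psi> \<circ> chart_inv c)" "\<forall>q\<in>V \<inter> fst c. \<psi> q = \<phi> q"
    using assms(3) by metis
  show "\<exists>T h. open T \<and> x \<in> T \<and> C_infinity_on T h \<and> (\<forall>y\<in>T. h y = (\<phi> \<circ> chart_inv c) y)"
    by (rule exI[of _ "snd c ` (V \<inter> fst c)"], rule exI[of _ "\<psi> \<circ> chart_inv c"])
       (use V p open_chart_image assms(1) chart_inv_chart in auto)
qed

lemma smooth_functions_local:
  assumes "open U"
    and "\<And>p. p \<in> U \<Longrightarrow> \<exists>V h. open V \<and> p \<in> V \<and> h \<in> smooth_functions A V \<and> (\<forall>q\<in>V. h q = f q)"
  shows "f \<in> smooth_functions A U"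
  unfolding smooth_functions_def
proof (intro CollectI ballI smooth_in_chart_local assms(1))
  fix c p assume "c \<in> A" "p \<in> U"
  then show "\<exists>V \<psi>. open V \<and> p \<in> V \<and>
      C_infinity_on (snd c ` (V \<inter> fst c)) (\<psi> \<circ> chart_inv c) \<and> (\<forall>q\<in>V \<inter> fst c. \<psi> q = f q)"
    using assms(2) unfolding smooth_functions_def by fast
qed

lemma vector_fields_local:
  assumes "open U"
    and "\<And>p. p \<in> U \<Longrightarrow> \<exists>V Y. open V \<and> p \<in> V \<and> Y \<in> vector_fields A V \<and> (\<forall>q\<in>V. Y q = X q)"
  shows "X \<in> vector_fields A U"
  unfolding vector_fields_def
proof (intro CollectI ballI smooth_in_chart_local assms(1))
  fix c p assume c: "c \<in> A" "p \<in> U"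
  then obtain V Y where V: "open V" "p \<in> V" "Y \<in> vector_fields A V" "\<forall>q\<in>V. Y q = X q"
    using assms(2) by metis
  then show "\<exists>V \<psi>. open V \<and> p \<in> V \<and>
      C_infinity_on (snd c ` (V \<inter> fst c)) (\<psi> \<circ> chart_inv c) \<and>
      (\<forall>q\<in>V \<inter> fst c. \<psi> q = components A c q (X q))"
    by (intro exI[of _ V] exI[of _ "\<lambda>q. components A c q (Y q)"])
       (use c in \<open>auto simp: vector_fields_def\<close>)
qed

section \<open>Restriction and algebra of smooth functions and fields\<close>

lemma smooth_functions_mono:
  "f \<in> smooth_functions A U \<Longrightarrow> open U \<Longrightarrow> open V \<Longrightarrow> V \<subseteq> U \<Longrightarrow> f \<in> smooth_functions A V"
  by (rule smooth_functions_local) blast+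

lemma vector_fields_mono:
  "X \<in> vector_fields A U \<Longrightarrow> open U \<Longrightarrow> open V \<Longrightarrow> V \<subseteq> U \<Longrightarrow> X \<in> vector_fields A V"
  by (rule vector_fields_local) blast+

text \<open>Moves the comparison with a coordinate expression \<open>h\<close> back to points of the
  chart domain, where \<open>components\<close> is linear and \<open>chart_inv\<close> really
  inverts the chart.\<close>

lemma smooth_in_chart_cong:
  assumes "c \<in> A" "open U" "C_infinity_on (snd c ` (U \<inter> fst c)) h"
    and "\<And>q. q \<in> U \<Longrightarrow> q \<in> fst c \<Longrightarrow> h (snd c q) = \<phi> q"
  shows "C_infinity_on (snd c ` (U \<inter> fst c)) (\<phi> \<circ> chart_inv c)"
proof (rule C_infinity_on_local[OF open_chart_image[OF assms(1,2)]])
  fix x assume "x \<in> snd c ` (U \<inter> fst c)"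
  then show "\<exists>T k. open T \<and> x \<in> T \<and> C_infinity_on T k \<and> (\<forall>y\<in>T. k y = (\<phi> \<circ> chart_inv c) y)"
    by (intro exI[of _ "snd c ` (U \<inter> fst c)"] exI[of _ h])
       (use assms open_chart_image chart_inv_chart in auto)
qed

lemma smooth_functions_const: "open U \<Longrightarrow> (\<lambda>p. b) \<in> smooth_functions A U"
  unfolding smooth_functions_def
  by (auto intro!: smooth_in_chart_cong[where h = "\<lambda>x. b"] simp: C_infinity_on_def C_k_on_const)

lemma vector_fields_zero: "open U \<Longrightarrow> (\<lambda>p. 0) \<in> vector_fields A U"
  unfolding vector_fields_def
  by (intro CollectI ballI smooth_in_chart_cong[where h = "\<lambda>x. 0"])
     (simp_all add: C_infinity_on_def C_k_on_const linear_0[OF linear_components])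

lemma vector_fields_add:
  assumes "open U" "X \<in> vector_fields A U" "Y \<in> vector_fields A U"
  shows "(\<lambda>p. X p + Y p) \<in> vector_fields A U"
  unfolding vector_fields_def
proof (intro CollectI ballI)
  fix c assume c: "c \<in> A"
  show "C_infinity_on (snd c ` (U \<inter> fst c)) ((\<lambda>p. components A c p (X p + Y p)) \<circ> chart_inv c)"
  proof (rule smooth_in_chart_cong[OF c assms(1)])
    show "C_infinity_on (snd c ` (U \<inter> fst c)) (\<lambda>x. ((\<lambda>p. components A c p (X p)) \<circ> chart_inv c) x +
        ((\<lambda>p. components A c p (Y p)) \<circ> chart_inv c) x)"
      by (rule C_infinity_on_add[OF open_chart_image[OF c assms(1)]])
         (use assms(2,3) c in \<open>simp_all add: vector_fields_def del: o_apply\<close>)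
  qed (simp add: c chart_inv_chart linear_add[OF linear_components])
qed

lemma vector_fields_scaleR:
  assumes "open U" "f \<in> smooth_functions A U" "X \<in> vector_fields A U"
  shows "(\<lambda>p. f p *\<^sub>R X p) \<in> vector_fields A U"
  unfolding vector_fields_def
proof (intro CollectI ballI)
  fix c assume c: "c \<in> A"
  show "C_infinity_on (snd c ` (U \<inter> fst c)) ((\<lambda>p. components A c p (f p *\<^sub>R X p)) \<circ> chart_inv c)"
  proof (rule smooth_in_chart_cong[OF c assms(1)])
    show "C_infinity_on (snd c ` (U \<inter> fst c))
        (\<lambda>x. (f \<circ> chart_inv c) x *\<^sub>R ((\<lambda>p. components A c p (X p)) \<circ> chart_inv c) x)"
      by (rule C_infinity_on_scaleR[OF open_chart_image[OF c assms(1)]])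
         (use assms(2,3) c in \<open>simp_all add: vector_fields_def smooth_functions_def del: o_apply\<close>)
  qed (simp add: c chart_inv_chart linear_scale[OF linear_components])
qed

lemma vector_fields_diff:
  assumes "open U" "X \<in> vector_fields A U" "Y \<in> vector_fields A U"
  shows "(\<lambda>p. X p - Y p) \<in> vector_fields A U"
  using vector_fields_add[OF assms(1,2) vector_fields_scaleR[OF assms(1) smooth_functions_const assms(3),
      of "- 1"]] assms(1) by simp

lemma vector_fields_sum:
  assumes "open U" "\<And>i. i \<in> I \<Longrightarrow> X i \<in> vector_fields A U"
  shows "(\<lambda>p. \<Sum>i\<in>I. X i p) \<in> vector_fields A U"
  using assms(2)
  by (induction I rule: infinite_finite_induct)
     (auto intro: vector_fields_zero vector_fields_add assms(1))

lemma smooth_functions_divide: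
  assumes "open U" "f \<in> smooth_functions A U" "h \<in> smooth_functions A U" "\<And>p. p \<in> U \<Longrightarrow> h p \<noteq> 0"
  shows "(\<lambda>p. f p / h p) \<in> smooth_functions A U"
  unfolding smooth_functions_def
proof (intro CollectI ballI)
  fix c assume c: "c \<in> A"
  have op: "open (snd c ` (U \<inter> fst c))"
    by (rule open_chart_image[OF c assms(1)])
  have f: "C_k_on k (snd c ` (U \<inter> fst c)) (f \<circ> chart_inv c)" for k
    using assms(2) c by (auto simp: smooth_functions_def C_infinity_on_def)
  have h: "C_k_on k (snd c ` (U \<inter> fst c)) (h \<circ> chart_inv c)" for k
    using assms(3) c by (auto simp: smooth_functions_def C_infinity_on_def)
  have "C_k_on k (snd c ` (U \<inter> fst c)) (\<lambda>x. inverse ((h \<circ> chart_inv c) x))" for k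
    by (rule C_k_on_compose[OF op _ _ h C_k_on_inverse_real])
       (use assms(4) c chart_inv_chart in auto)
  note C_k_on_scaleR[OF op f this]
  then show "C_infinity_on (snd c ` (U \<inter> fst c)) ((\<lambda>p. f p / h p) \<circ> chart_inv c)"
    by (intro smooth_in_chart_cong[OF c assms(1), where
          h = "\<lambda>x. (f \<circ> chart_inv c) x *\<^sub>R inverse ((h \<circ> chart_inv c) x)"])
       (simp_all add: C_infinity_on_def chart_inv_chart c divide_inverse)
qed

section \<open>Cut-off functions and extension of local fields\<close>

text \<open>A Euclidean bump is pulled back through a chart at \<open>p\<close> and extended by 0.
  The set \<open>K\<close> is the image of a closed ball, hence compact, hence closed in the
  Hausdorff space. The chart domain and the complement of \<open>K\<close> are therefore an open
  cover, with the function smooth on the first and zero on the second. \<open>K\<close> is exported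
  so that products with local fields can be extended by 0 in the same way.\<close>

lemma bump_function:
  assumes "open U" "p \<in> U"
  obtains f V K where "f \<in> smooth_functions A UNIV" "open V" "p \<in> V" "closed K" "K \<subseteq> U"
    "\<And>q. q \<in> V \<Longrightarrow> f q = 1" "\<And>q. q \<notin> K \<Longrightarrow> f q = 0"
proof -
  define c where "c = chart_at A p"
  have c: "c \<in> A" "p \<in> fst c"
    using chart_at by (auto simp: c_def)
  have "open (snd c ` (U \<inter> fst c))" "snd c p \<in> snd c ` (U \<inter> fst c)"
    using open_chart_image c assms by auto
  then obtain r where r: "r > 0" "cball (snd c p) r \<subseteq> snd c ` (U \<inter> fst c)"
    unfolding open_contains_cball by blast
  obtain b where b: "C_infinity_on UNIV b" "\<And>x. dist x (snd c p) \<le> r / 2 \<Longrightarrow> b x = 1"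
    "\<And>x. dist x (snd c p) \<ge> r \<Longrightarrow> b x = (0::real)"
    using smooth_bump[OF r(1)] by metis
  define f where "f q = (if q \<in> fst c then b (snd c q) else 0)" for q
  define K where "K = chart_inv c ` cball (snd c p) r"
  define V where "V = fst c \<inter> snd c -` ball (snd c p) (r / 2)"
  have "continuous_on (cball (snd c p) r) (chart_inv c)"
    by (rule continuous_on_subset[OF homeomorphism_cont2[OF chart_homeomorphism[OF c(1)]]])
       (use r(2) in auto)
  then have "compact K"
    unfolding K_def by (rule compact_continuous_image) simp
  then have K: "closed K"
    by (rule compact_imp_closed)
  have KU: "K \<subseteq> U"
    unfolding K_def
  proof
    fix q assume "q \<in> chart_inv c ` cball (snd c p) r"
    then obtain q' where "q' \<in> U" "q' \<in> fst c" "q = chart_inv c (snd c q')"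
      using r(2) by fast
    then show "q \<in> U"
      using chart_inv_chart c(1) by simp
  qed
  have f0: "f q = 0" if "q \<notin> K" for q
  proof (cases "q \<in> fst c")
    case True
    then have "snd c q \<notin> cball (snd c p) r"
      using that chart_inv_chart[OF c(1)] unfolding K_def by force
    then show ?thesis
      using b(3) by (simp add: f_def dist_commute)
  qed (simp add: f_def)
  have V: "open V"
    unfolding V_def
    using continuous_open_preimage[OF homeomorphism_cont1[OF chart_homeomorphism[OF c(1)]]
        open_chart_domain[OF c(1)]] by blast
  have pV: "p \<in> V"
    using c r(1) by (simp add: V_def)
  have f1: "f q = 1" if "q \<in> V" for q
    using that b(2) by (simp add: V_def f_def dist_commute)
  have bc: "(\<lambda>q. b (snd c q)) \<in> smooth_functions A (fst c)"
    unfolding smooth_functions_def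
  proof (intro CollectI ballI)
    fix d assume d: "d \<in> A"
    have "C_k_on k (snd d ` (fst c \<inter> fst d)) (\<lambda>x. b ((snd c \<circ> chart_inv d) x))" for k
      by (rule C_k_on_compose[OF open_chart_image[OF d open_chart_domain[OF c(1)]] open_UNIV subset_UNIV
            C_infinity_onD[OF transition_smooth[OF d c(1), unfolded Int_commute[of "fst d"]]]
            C_infinity_onD[OF b(1)]])
    then show "C_infinity_on (snd d ` (fst c \<inter> fst d)) ((\<lambda>q. b (snd c q)) \<circ> chart_inv d)"
      by (simp add: C_infinity_on_def comp_def)
  qed
  have "f \<in> smooth_functions A UNIV"
  proof (rule smooth_functions_local[OF open_UNIV])
    fix q
    show "\<exists>V h. open V \<and> q \<in> V \<and> h \<in> smooth_functions A V \<and> (\<forall>q'\<in>V. h q' = f q')"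
    proof (cases "q \<in> fst c")
      case True
      then show ?thesis
        using bc open_chart_domain[OF c(1)] by (metis f_def)
    next
      case False
      have "q \<notin> K"
        using False r(2) chart_inv_chart[OF c(1)] unfolding K_def by fastforce
      then show ?thesis
        using f0 K smooth_functions_const[of "- K" 0]
        by (intro exI[of _ "- K"] exI[of _ "\<lambda>_. 0"]) auto
    qed
  qed
  then show thesis
    using that V pV K KU f1 f0 by blast
qed

text \<open>Guarantees that the choice in \<open>local_nabla\<close> has a witness. The product of
  \<open>Z\<close> with a bump function is smooth on \<open>U\<close>, vanishes on the open
  complement of \<open>K\<close>, and equals \<open>Z\<close> where the bump is 1.\<close>

lemma vector_field_extension:
  assumes "open U" "p \<in> U" "Z \<in> vector_fields A U"
  shows "\<exists>W\<in>vector_fields A UNIV. \<forall>\<^sub>F q in nhds p. W q = Z q"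
proof -
  obtain f V K where f: "f \<in> smooth_functions A UNIV" "open V" "p \<in> V" "closed K" "K \<subseteq> U"
    "\<And>q. q \<in> V \<Longrightarrow> f q = 1" "\<And>q. q \<notin> K \<Longrightarrow> f q = 0"
    using bump_function[OF assms(1,2)] by blast
  have fZ: "(\<lambda>q. f q *\<^sub>R Z q) \<in> vector_fields A U"
    by (rule vector_fields_scaleR[OF assms(1) smooth_functions_mono[OF f(1)] assms(3)])
       (use assms(1) in auto)
  have "(\<lambda>q. f q *\<^sub>R Z q) \<in> vector_fields A UNIV"
  proof (rule vector_fields_local[OF open_UNIV])
    fix q
    show "\<exists>V Y. open V \<and> q \<in> V \<and> Y \<in> vector_fields A V \<and> (\<forall>q'\<in>V. Y q' = f q' *\<^sub>R Z q')"
    proof (cases "q \<in> U")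
      case True
      then show ?thesis
        using fZ assms(1) by blast
    next
      case False
      then show ?thesis
        using f vector_fields_zero[of "- K"]
        by (intro exI[of _ "- K"] exI[of _ "\<lambda>_. 0"]) auto
    qed
  qed
  moreover have "\<forall>\<^sub>F q in nhds p. f q *\<^sub>R Z q = Z q"
    using eventually_nhds_in_open[OF f(2,3)] by eventually_elim (simp add: f(6))
  ultimately show ?thesis
    by (intro bexI[of _ "\<lambda>q. f q *\<^sub>R Z q"])
qed

section \<open>Locality of a connection\<close>

context
  fixes nabla :: "('a, 'm) connection"
  assumes conn: "affine_connection A nabla"
begin

lemma nabla_smooth:
    "X \<in> vector_fields A UNIV \<Longrightarrow> Y \<in> vector_fields A UNIV \<Longrightarrow> nabla X Y \<in> vector_fields A UNIV"
  and nabla_add_direction: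
    "X \<in> vector_fields A UNIV \<Longrightarrow> X' \<in> vector_fields A UNIV \<Longrightarrow> Y \<in> vector_fields A UNIV \<Longrightarrow>
      nabla (\<lambda>p. X p + X' p) Y = (\<lambda>p. nabla X Y p + nabla X' Y p)"
  and nabla_add:
    "X \<in> vector_fields A UNIV \<Longrightarrow> Y \<in> vector_fields A UNIV \<Longrightarrow> Y' \<in> vector_fields A UNIV \<Longrightarrow>
      nabla X (\<lambda>p. Y p + Y' p) = (\<lambda>p. nabla X Y p + nabla X Y' p)"
  and nabla_scaleR:
    "f \<in> smooth_functions A UNIV \<Longrightarrow> X \<in> vector_fields A UNIV \<Longrightarrow> Y \<in> vector_fields A UNIV \<Longrightarrow>
      nabla X (\<lambda>p. f p *\<^sub>R Y p) = (\<lambda>p. f p *\<^sub>R nabla X Y p + dir_deriv A X f p *\<^sub>R Y p)"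
  using conn unfolding affine_connection_def by blast+

lemma nabla_zero:
  assumes "X \<in> vector_fields A UNIV"
  shows "nabla X (\<lambda>p. 0) p = 0"
  using fun_cong[OF nabla_add[OF assms vector_fields_zero vector_fields_zero], of p] by simp

text \<open>Cutting off with a bump function turns local agreement into the global equality of
  \<open>f\<close> times \<open>Y\<close> and \<open>f\<close> times \<open>Y'\<close>. Applying the
  Leibniz rule to both sides at \<open>p\<close>, the terms with \<open>dir_deriv\<close> cancel
  because \<open>Y p = Y' p\<close>, and \<open>f p = 1\<close> leaves the claim.\<close>

lemma nabla_local:
  assumes "X \<in> vector_fields A UNIV" "Y \<in> vector_fields A UNIV" "Y' \<in> vector_fields A UNIV"
    and "\<forall>\<^sub>F q in nhds p. Y q = Y' q"
  shows "nabla X Y p = nabla X Y' p"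
proof -
  obtain U where U: "open U" "p \<in> U" "\<And>q. q \<in> U \<Longrightarrow> Y q = Y' q"
    using assms(4) unfolding eventually_nhds by blast
  obtain f V K where f: "f \<in> smooth_functions A UNIV" "open V" "p \<in> V" "closed K" "K \<subseteq> U"
    "\<And>q. q \<in> V \<Longrightarrow> f q = 1" "\<And>q. q \<notin> K \<Longrightarrow> f q = 0"
    using bump_function[OF U(1,2)] by blast
  have "(\<lambda>q. f q *\<^sub>R Y q) = (\<lambda>q. f q *\<^sub>R Y' q)"
    using U(3) f(5,7) by (metis (no_types, opaque_lifting) scaleR_zero_left subset_iff)
  then have "f p *\<^sub>R nabla X Y p + dir_deriv A X f p *\<^sub>R Y p
      = f p *\<^sub>R nabla X Y' p + dir_deriv A X f p *\<^sub>R Y' p"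
    using fun_cong[OF nabla_scaleR[OF f(1) assms(1,2)], of p]
      fun_cong[OF nabla_scaleR[OF f(1) assms(1,3)], of p] by simp
  then show ?thesis
    using f(3,6) U(2,3) by simp
qed

lemma nabla_sum_scaleR:
  assumes "X \<in> vector_fields A UNIV" "\<And>j. j \<in> J \<Longrightarrow> f j \<in> smooth_functions A UNIV"
    "\<And>j. j \<in> J \<Longrightarrow> W j \<in> vector_fields A UNIV"
  shows "nabla X (\<lambda>q. \<Sum>j\<in>J. f j q *\<^sub>R W j q) p
    = (\<Sum>j\<in>J. f j p *\<^sub>R nabla X (W j) p + dir_deriv A X (f j) p *\<^sub>R W j p)"
  using assms(2,3)
proof (induction J rule: infinite_finite_induct)
  case (insert i J)
  have "nabla X (\<lambda>q. f i q *\<^sub>R W i q + (\<Sum>j\<in>J. f j q *\<^sub>R W j q)) =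
      (\<lambda>p. nabla X (\<lambda>q. f i q *\<^sub>R W i q) p + nabla X (\<lambda>q. \<Sum>j\<in>J. f j q *\<^sub>R W j q) p)"
    using insert.prems by (intro nabla_add assms(1) vector_fields_sum vector_fields_scaleR) auto
  then show ?case
    using insert nabla_scaleR[OF _ assms(1), of "f i" "W i"] by simp
qed (simp_all add: nabla_zero[OF assms(1)])

end

end

section \<open>Orthogonal projections\<close>

lemma bilinear_eq_0_on_span:
  assumes "bilinear b" "\<And>i. i \<in> J \<Longrightarrow> b u (F i) = 0" "w \<in> span (F ` J)"
  shows "b u w = (0::real)"
  by (rule linear_eq_0_on_span[of "b u" "F ` J"]) (use assms in \<open>auto simp: bilinear_def\<close>)

text \<open>Pairing the sum with \<open>F i\<close> leaves only the term \<open>j = i\<close>, whose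
  coefficient is chosen to reproduce \<open>b v (F i)\<close>.\<close>

lemma orthogonal_residual:
  fixes b :: "'v::real_vector \<Rightarrow> 'v \<Rightarrow> real"
  assumes "bilinear b" "finite J" "i \<in> J" "b (F i) (F i) \<noteq> 0"
    and "\<And>j. j \<in> J \<Longrightarrow> j \<noteq> i \<Longrightarrow> b (F j) (F i) = 0"
  shows "b (v - (\<Sum>j\<in>J. (b v (F j) / b (F j) (F j)) *\<^sub>R F j)) (F i) = 0"
proof -
  have lin: "linear (\<lambda>x. b x (F i))"
    using assms(1) by (simp add: bilinear_def)
  have "b (\<Sum>j\<in>J. (b v (F j) / b (F j) (F j)) *\<^sub>R F j) (F i)
      = (\<Sum>j\<in>J. (b v (F j) / b (F j) (F j)) * b (F j) (F i))"
    by (simp add: linear_sum[OF lin] linear_scale[OF lin])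
  also have "\<dots> = (\<Sum>j\<in>J. if j = i then b v (F i) else 0)"
    using assms(4,5) by (intro sum.cong) auto
  also have "\<dots> = b v (F i)"
    using assms(2,3) by simp
  finally show ?thesis
    by (simp add: linear_diff[OF lin])
qed

lemma span_insert_diff:
  assumes "w \<in> span S"
  shows "span (insert (v - w) S) = span (insert v S)"
proof -
  have w: "w \<in> span (insert x S)" for x
    using assms span_mono[of S "insert x S"] by blast
  have "v \<in> span (insert (v - w) S)"
    using span_add[OF span_base[of "v - w"] w, of "v - w"] by simp
  moreover have "v - w \<in> span (insert v S)"
    by (intro span_diff w span_base) simp
  ultimately show ?thesis
    by (intro equalityI span_minimal subspace_span) (auto intro: span_base)
qed

locale riemannian_manifold = smooth_manifold A
  for A :: "('a::{t2_space, second_countable_topology}, 'm::finite) chart set" +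
  fixes g :: "('a, 'm) metric"
  assumes metric: "riemannian_metric A g"
begin

lemma bilinear_metric: "bilinear (g p)"
  and metric_commute: "g p v w = g p w v"
  and metric_pos: "v \<noteq> 0 \<Longrightarrow> g p v v > 0"
  and metric_smooth: "open U \<Longrightarrow> X \<in> vector_fields A U \<Longrightarrow> Y \<in> vector_fields A U \<Longrightarrow>
      (\<lambda>p. g p (X p) (Y p)) \<in> smooth_functions A U"
  using metric unfolding riemannian_metric_def by blast+

lemma metric_self_eq_0: "g p v v = 0 \<longleftrightarrow> v = 0"
  using metric_pos[of v p] bilinear_lzero[OF bilinear_metric, of p v] by fastforce

lemma subspace_orth_compl: "subspace (orth_compl g D p)"
  using bilinear_metric[of p] unfolding orth_compl_def
  by (auto simp: subspace_def bilinear_lzero bilinear_ladd bilinear_lmul)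

text \<open>The difference of two candidates lies in \<open>D p\<close> and is orthogonal to
  \<open>D p\<close>, so it is orthogonal to itself and vanishes by positive definiteness. This is
  the uniqueness required by \<open>THE\<close>.\<close>

lemma orth_proj_eqI:
  assumes "subspace (D p)" "v \<in> D p" "X p - v \<in> orth_compl g D p"
  shows "orth_proj g D X p = v"
  unfolding orth_proj_def
proof (rule the_equality)
  fix v' assume v': "v' \<in> D p \<and> X p - v' \<in> orth_compl g D p"
  have "(X p - v) - (X p - v') \<in> orth_compl g D p"
    using v' assms(3) subspace_orth_compl subspace_diff by blast
  moreover have "v' - v \<in> D p"
    using v' assms(1,2) subspace_diff by blast
  ultimately have "g p (v' - v) (v' - v) = 0"
    by (simp add: orth_compl_def)
  then show "v' = v"
    using metric_self_eq_0 by fastforce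
qed (use assms in auto)

text \<open>Without normalisation the coefficients are quotients of smooth functions with
  nonvanishing denominators, and no square root has to be differentiated. Independence is stated
  triangularly because this is what the step consumes: \<open>P q\<close> lies in the span of the
  earlier vectors and \<open>E k q\<close> does not, so \<open>H q\<close> is nonzero.\<close>

lemma gram_schmidt_frame:
  fixes k :: nat
  assumes "open U" "\<And>i. i < k \<Longrightarrow> E i \<in> vector_fields A U"
    and "\<And>q i. q \<in> U \<Longrightarrow> i < k \<Longrightarrow> E i q \<notin> span ((\<lambda>j. E j q) ` {..<i})"
  shows "\<exists>F. (\<forall>i<k. F i \<in> vector_fields A U) \<and>
    (\<forall>q\<in>U. (\<forall>i<k. F i q \<noteq> 0) \<and> (\<forall>i<k. \<forall>j<k. i \<noteq> j \<longrightarrow> g q (F i q) (F j q) = 0) \<and>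
       span ((\<lambda>i. F i q) ` {..<k}) = span ((\<lambda>i. E i q) ` {..<k}))"
  using assms(2,3)
proof (induction k)
  case 0
  then show ?case by auto
next
  case (Suc k)
  have "\<exists>F. (\<forall>i<k. F i \<in> vector_fields A U) \<and>
    (\<forall>q\<in>U. (\<forall>i<k. F i q \<noteq> 0) \<and> (\<forall>i<k. \<forall>j<k. i \<noteq> j \<longrightarrow> g q (F i q) (F j q) = 0) \<and>
       span ((\<lambda>i. F i q) ` {..<k}) = span ((\<lambda>i. E i q) ` {..<k}))"
    by (rule Suc.IH) (use Suc.prems in simp_all)
  then obtain F where "\<forall>i<k. F i \<in> vector_fields A U"
    "\<forall>q\<in>U. (\<forall>i<k. F i q \<noteq> 0) \<and> (\<forall>i<k. \<forall>j<k. i \<noteq> j \<longrightarrow> g q (F i q) (F j q) = 0) \<and>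
       span ((\<lambda>i. F i q) ` {..<k}) = span ((\<lambda>i. E i q) ` {..<k})"
    by (elim exE conjE)
  then have F: "\<And>i. i < k \<Longrightarrow> F i \<in> vector_fields A U"
    "\<And>q i. q \<in> U \<Longrightarrow> i < k \<Longrightarrow> F i q \<noteq> 0"
    "\<And>q i j. q \<in> U \<Longrightarrow> i < k \<Longrightarrow> j < k \<Longrightarrow> i \<noteq> j \<Longrightarrow> g q (F i q) (F j q) = 0"
    "\<And>q. q \<in> U \<Longrightarrow> span ((\<lambda>i. F i q) ` {..<k}) = span ((\<lambda>i. E i q) ` {..<k})"
    by simp_all
  define P where "P q = (\<Sum>j<k. (g q (E k q) (F j q) / g q (F j q) (F j q)) *\<^sub>R F j q)" for q
  define H where "H q = E k q - P q" for q
  define F' where "F' = F(k := H)"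
  have nz: "g q (F i q) (F i q) \<noteq> 0" if "q \<in> U" "i < k" for q i
    using metric_self_eq_0 F(2) that by blast
  have H_smooth: "H \<in> vector_fields A U"
    unfolding H_def P_def using F(1) nz Suc.prems(1) assms(1)
    by (intro vector_fields_diff vector_fields_sum vector_fields_scaleR smooth_functions_divide
        metric_smooth) auto
  have P_span: "P q \<in> span ((\<lambda>i. F i q) ` {..<k})" for q
    unfolding P_def by (intro span_sum span_scale span_base) auto
  have H_nz: "H q \<noteq> 0" if "q \<in> U" for q
    using Suc.prems(2)[OF that, of k] P_span[of q] F(4)[OF that] by (auto simp: H_def)
  have H_orth: "g q (H q) (F i q) = 0" if "q \<in> U" "i < k" for q i
    unfolding H_def P_def
    by (rule orthogonal_residual[OF bilinear_metric, where F = "\<lambda>j. F j q"])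
       (use that F(3) nz in auto)
  have "span ((\<lambda>i. F' i q) ` {..<Suc k}) = span ((\<lambda>i. E i q) ` {..<Suc k})" if "q \<in> U" for q
  proof -
    have "(\<lambda>i. F' i q) ` {..<Suc k} = insert (E k q - P q) ((\<lambda>i. F i q) ` {..<k})"
      by (auto simp: F'_def lessThan_Suc H_def)
    then have "span ((\<lambda>i. F' i q) ` {..<Suc k}) = span (insert (E k q) ((\<lambda>i. F i q) ` {..<k}))"
      using span_insert_diff[OF P_span] by simp
    also have "\<dots> = span (insert (E k q) ((\<lambda>i. E i q) ` {..<k}))"
      using F(4)[OF that] by (simp add: span_insert)
    finally show ?thesis by (simp add: lessThan_Suc)
  qed
  then show ?case
    using F(1-3) H_smooth H_nz H_orth metric_commute
    by (intro exI[of _ F']) (auto simp: F'_def less_Suc_eq)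
qed

text \<open>The existence half of the projection. The explicit Fourier sum also serves later to
  prove that projected fields are smooth.\<close>

lemma orth_proj_orth_expansion:
  fixes k :: nat
  assumes "D p = span ((\<lambda>i. F i) ` {..<k})" "\<And>i. i < k \<Longrightarrow> F i \<noteq> 0"
    and "\<And>i j. i < k \<Longrightarrow> j < k \<Longrightarrow> i \<noteq> j \<Longrightarrow> g p (F i) (F j) = 0"
  defines "P \<equiv> \<lambda>v. \<Sum>j<k. (g p v (F j) / g p (F j) (F j)) *\<^sub>R F j"
  shows "P v \<in> D p" "v - P v \<in> orth_compl g D p"
proof -
  show "P v \<in> D p"
    unfolding P_def assms(1) by (intro span_sum span_scale span_base) auto
  have "g p (v - P v) (F i) = 0" if "i < k" for i
    unfolding P_def
    by (rule orthogonal_residual[OF bilinear_metric]) (use that assms(2,3) metric_self_eq_0 in auto)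
  then show "v - P v \<in> orth_compl g D p"
    unfolding orth_compl_def assms(1)
    using bilinear_eq_0_on_span[OF bilinear_metric, of "{..<k}" p "v - P v" F] by auto
qed

text \<open>The remainder of the Fourier sum lies in the span and is orthogonal to it, hence is
  zero.\<close>

lemma orthonormal_expansion:
  assumes "finite J" "\<And>i j. i \<in> J \<Longrightarrow> j \<in> J \<Longrightarrow> g p (F i) (F j) = (if i = j then 1 else 0)"
    and "v \<in> span (F ` J)"
  shows "v = (\<Sum>j\<in>J. g p v (F j) *\<^sub>R F j)"
proof -
  let ?r = "v - (\<Sum>j\<in>J. (g p v (F j) / g p (F j) (F j)) *\<^sub>R F j)"
  have "g p ?r (F i) = 0" if "i \<in> J" for i
    by (rule orthogonal_residual[OF bilinear_metric assms(1) that]) (use assms(2) that in auto)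
  moreover have "?r \<in> span (F ` J)"
    by (intro span_diff assms(3) span_sum span_scale span_base) auto
  ultimately have "g p ?r ?r = 0"
    using bilinear_eq_0_on_span[OF bilinear_metric] by blast
  then have "?r = 0"
    by (simp only: metric_self_eq_0)
  then show ?thesis
    using assms(2) by simp
qed

end

locale riemannian_distribution = riemannian_manifold A g
  for A :: "('a::{t2_space, second_countable_topology}, 'm::finite) chart set" and g +
  fixes n :: nat and D :: "('a, 'm) distribution"
  assumes regular: "regular_distribution A n D"
begin

section \<open>The projection onto a regular distribution\<close>

lemma subspace_distribution: "subspace (D p)"
  using regular by (simp add: regular_distribution_def)

lemma local_orthogonal_frame:
  obtains U F where "open U" "p \<in> U" "\<And>i. i < n \<Longrightarrow> F i \<in> vector_fields A U"
    "\<And>q. q \<in> U \<Longrightarrow> D q = span ((\<lambda>i. F i q) ` {..<n})"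
    "\<And>q i. q \<in> U \<Longrightarrow> i < n \<Longrightarrow> F i q \<noteq> 0"
    "\<And>q i j. q \<in> U \<Longrightarrow> i < n \<Longrightarrow> j < n \<Longrightarrow> i \<noteq> j \<Longrightarrow> g q (F i q) (F j q) = 0"
proof -
  obtain U E where U: "open U" "p \<in> U" "\<And>i. i < n \<Longrightarrow> E i \<in> sections A D U"
    "\<And>q. q \<in> U \<Longrightarrow> span ((\<lambda>i. E i q) ` {..<n}) = D q"
    using regular unfolding regular_distribution_def by metis
  \<comment> \<open>Here the rank enters: if \<open>E i q\<close> depended on its predecessors, the
    fewer than \<open>n\<close> remaining vectors would still span \<open>D q\<close>, whose
    dimension is \<open>n\<close>.\<close>
  have "E i q \<notin> span ((\<lambda>j. E j q) ` {..<i})" if "q \<in> U" "i < n" for q i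
  proof
    assume *: "E i q \<in> span ((\<lambda>j. E j q) ` {..<i})"
    let ?S = "(\<lambda>j. E j q) ` ({..<n} - {i})"
    have "E i q \<in> span ?S"
      using * span_mono[of "(\<lambda>j. E j q) ` {..<i}" ?S] that by fastforce
    moreover have "(\<lambda>j. E j q) ` {..<n} = insert (E i q) ?S"
      using that by auto
    ultimately have "D q = span ?S"
      using U(4)[OF that(1)] span_redundant by metis
    then have "dim (D q) \<le> card ?S"
      by (intro dim_le_card) auto
    also have "\<dots> \<le> card ({..<n} - {i})"
      by (intro card_image_le) simp
    also have "\<dots> < n"
      using that by simp
    finally show False
      using regular by (simp add: regular_distribution_def)
  qed
  then obtain F where "\<forall>i<n. F i \<in> vector_fields A U"
    "\<forall>q\<in>U. (\<forall>i<n. F i q \<noteq> 0) \<and> (\<forall>i<n. \<forall>j<n. i \<noteq> j \<longrightarrow> g q (F i q) (F j q) = 0) \<and>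
       span ((\<lambda>i. F i q) ` {..<n}) = span ((\<lambda>i. E i q) ` {..<n})"
    using gram_schmidt_frame[OF U(1), of n E] U(3) by (auto simp: sections_def)
  then show thesis
    using that[of U F] U(1,2,4) by auto
qed

lemma orth_proj_in: "orth_proj g D X p \<in> D p"
  and orth_proj_residual: "X p - orth_proj g D X p \<in> orth_compl g D p"
proof -
  obtain U F where F: "p \<in> U" "\<And>q. q \<in> U \<Longrightarrow> D q = span ((\<lambda>i. F i q) ` {..<n})"
    "\<And>q i. q \<in> U \<Longrightarrow> i < n \<Longrightarrow> F i q \<noteq> 0"
    "\<And>q i j. q \<in> U \<Longrightarrow> i < n \<Longrightarrow> j < n \<Longrightarrow> i \<noteq> j \<Longrightarrow> g q (F i q) (F j q) = 0"
    using local_orthogonal_frame[of p] by metis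
  let ?v = "\<Sum>j<n. (g p (X p) (F j p) / g p (F j p) (F j p)) *\<^sub>R F j p"
  have "?v \<in> D p" "X p - ?v \<in> orth_compl g D p"
    using F(1) by (auto intro!: orth_proj_orth_expansion F(2,4) simp: F(3))
  then show "orth_proj g D X p \<in> D p" "X p - orth_proj g D X p \<in> orth_compl g D p"
    using orth_proj_eqI[of D p ?v X] subspace_distribution by simp_all
qed

text \<open>Near each point the projection is the Fourier sum over a smooth orthogonal frame, and
  smoothness is local.\<close>

lemma orth_proj_smooth:
  assumes "X \<in> vector_fields A UNIV"
  shows "orth_proj g D X \<in> vector_fields A UNIV"
proof (rule vector_fields_local[OF open_UNIV])
  fix p
  obtain U F where F: "open U" "p \<in> U" "\<And>i. i < n \<Longrightarrow> F i \<in> vector_fields A U"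
    "\<And>q. q \<in> U \<Longrightarrow> D q = span ((\<lambda>i. F i q) ` {..<n})"
    "\<And>q i. q \<in> U \<Longrightarrow> i < n \<Longrightarrow> F i q \<noteq> 0"
    "\<And>q i j. q \<in> U \<Longrightarrow> i < n \<Longrightarrow> j < n \<Longrightarrow> i \<noteq> j \<Longrightarrow> g q (F i q) (F j q) = 0"
    using local_orthogonal_frame[of p] by metis
  let ?P = "\<lambda>q. \<Sum>j<n. (g q (X q) (F j q) / g q (F j q) (F j q)) *\<^sub>R F j q"
  have X: "X \<in> vector_fields A U"
    using vector_fields_mono[OF assms] F(1) by simp
  have "?P \<in> vector_fields A U"
    by (intro vector_fields_sum vector_fields_scaleR smooth_functions_divide metric_smooth F(1) X)
       (use F(3,5) metric_self_eq_0 in auto)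
  moreover have "?P q = orth_proj g D X q" if q: "q \<in> U" for q
    using q by (auto intro!: orth_proj_eqI[symmetric] subspace_distribution orth_proj_orth_expansion F(4,6) simp: F(5))
  ultimately show "\<exists>V Y. open V \<and> p \<in> V \<and> Y \<in> vector_fields A V \<and> (\<forall>q\<in>V. Y q = orth_proj g D X q)"
    using F(1,2) by blast
qed

lemma orth_proj_cong: "X p = Y p \<Longrightarrow> orth_proj g D X p = orth_proj g D Y p"
  by (simp add: orth_proj_def)

lemma orth_proj_add: "orth_proj g D (\<lambda>q. X q + Y q) p = orth_proj g D X p + orth_proj g D Y p"
proof (intro orth_proj_eqI subspace_distribution subspace_add orth_proj_in)
  show "X p + Y p - (orth_proj g D X p + orth_proj g D Y p) \<in> orth_compl g D p"
    using subspace_add[OF subspace_orth_compl orth_proj_residual[of X p] orth_proj_residual[of Y p]]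
    by (simp add: algebra_simps)
qed

lemma orth_proj_scaleR: "orth_proj g D (\<lambda>q. f q *\<^sub>R X q) p = f p *\<^sub>R orth_proj g D X p"
proof (intro orth_proj_eqI subspace_distribution subspace_scale orth_proj_in)
  show "f p *\<^sub>R X p - f p *\<^sub>R orth_proj g D X p \<in> orth_compl g D p"
    using subspace_scale[OF subspace_orth_compl orth_proj_residual[of X p], of "f p"]
    by (simp add: scaleR_diff_right)
qed

lemma orth_proj_diff: "orth_proj g D (\<lambda>q. X q - Y q) p = orth_proj g D X p - orth_proj g D Y p"
  using orth_proj_add[of X "\<lambda>q. - 1 *\<^sub>R Y q" p] orth_proj_scaleR[of "\<lambda>q. - 1" Y p] by simp

lemma orth_proj_sum:
  "orth_proj g D (\<lambda>q. \<Sum>i\<in>I. X i q) p = (\<Sum>i\<in>I. orth_proj g D (X i) p)"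
proof -
  have zero: "orth_proj g D (\<lambda>q. 0) p = 0"
    using orth_proj_scaleR[of "\<lambda>q. 0" "\<lambda>q. 0" p] by simp
  show ?thesis
    by (induction I rule: infinite_finite_induct) (simp_all add: zero orth_proj_add)
qed

lemma orth_proj_normal: "X p \<in> orth_compl g D p \<Longrightarrow> orth_proj g D X p = 0"
  by (intro orth_proj_eqI subspace_distribution) (simp_all add: subspace_0 subspace_distribution)

text \<open>By symmetry of the metric, \<open>D p\<close> is orthogonal to its complement. The
  formula reduces smoothness of the normal part of a field to \<open>orth_proj_smooth\<close>, so no
  frame of the complement has to be built.\<close>

lemma orth_proj_orth_compl: "orth_proj g (orth_compl g D) X p = X p - orth_proj g D X p"
proof (intro orth_proj_eqI subspace_orth_compl orth_proj_residual)
  show "X p - (X p - orth_proj g D X p) \<in> orth_compl g (orth_compl g D) p"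
    using orth_proj_in[of X p] metric_commute by (auto simp: orth_compl_def)
qed

end

section \<open>The Gauss equation\<close>

locale levi_civita_distribution = riemannian_distribution A g n D
  for A :: "('a::{t2_space, second_countable_topology}, 'm::finite) chart set" and g n D +
  fixes nabla :: "('a, 'm) connection"
  assumes levi_civita: "levi_civita A g nabla"
begin

lemma connection: "affine_connection A nabla"
  using levi_civita by (simp add: levi_civita_def)

lemmas conn_smooth = nabla_smooth[OF connection]

lemma lie_bracket_smooth:
  assumes "X \<in> vector_fields A UNIV" "Y \<in> vector_fields A UNIV"
  shows "lie_bracket A X Y \<in> vector_fields A UNIV"
proof -
  have "lie_bracket A X Y = (\<lambda>p. nabla X Y p - nabla Y X p)"
    using levi_civita assms unfolding levi_civita_def by metis
  then show ?thesis
    using assms by (simp add: vector_fields_diff conn_smooth)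
qed

lemma intrinsic_connection_smooth:
  "X \<in> vector_fields A UNIV \<Longrightarrow> Y \<in> vector_fields A UNIV \<Longrightarrow>
    intrinsic_connection g nabla D X Y \<in> vector_fields A UNIV"
  unfolding intrinsic_connection_def by (intro orth_proj_smooth conn_smooth)

lemma second_fund_form_smooth:
  assumes "X \<in> vector_fields A UNIV" "Y \<in> vector_fields A UNIV"
  shows "second_fund_form g nabla D X Y \<in> vector_fields A UNIV"
  using vector_fields_diff[OF open_UNIV conn_smooth[OF assms] intrinsic_connection_smooth[OF assms]]
  by (simp add: second_fund_form_def[abs_def])

lemma second_fund_form_normal: "second_fund_form g nabla D X Y p \<in> orth_compl g D p"
  unfolding second_fund_form_def intrinsic_connection_def by (rule orth_proj_residual)

text \<open>The origin of the second fundamental form terms: the inner intrinsic derivative is the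
  full one minus its normal part, and that part is differentiated once more before
  projecting.\<close>

lemma intrinsic_connection_intrinsic:
  assumes "X \<in> vector_fields A UNIV" "Y \<in> vector_fields A UNIV" "W \<in> vector_fields A UNIV"
  shows "intrinsic_connection g nabla D X (intrinsic_connection g nabla D Y W) p =
    orth_proj g D (nabla X (nabla Y W)) p - orth_proj g D (nabla X (second_fund_form g nabla D Y W)) p"
proof -
  have "nabla Y W = (\<lambda>p. intrinsic_connection g nabla D Y W p + second_fund_form g nabla D Y W p)"
    by (simp add: second_fund_form_def)
  then have "nabla X (nabla Y W) = (\<lambda>p. nabla X (intrinsic_connection g nabla D Y W) p
      + nabla X (second_fund_form g nabla D Y W) p)"
    using nabla_add[OF connection assms(1) intrinsic_connection_smooth[OF assms(2,3)]
        second_fund_form_smooth[OF assms(2,3)]] by simp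
  then show ?thesis
    \<comment> \<open>The instantiation unfolds only the outer connection, along \<open>X\<close>,
      and keeps the inner one folded.\<close>
    by (simp add: orth_proj_add intrinsic_connection_def[of _ _ _ X])
qed

text \<open>The intrinsic curvature subtracts the derivative along the tangential part of the
  bracket only, while the ambient curvature subtracts it along the whole bracket. The derivative
  along the normal part must be added back, which is the last term.\<close>

lemma gauss_equation:
  assumes "X\<^sub>1 \<in> vector_fields A UNIV" "X\<^sub>2 \<in> vector_fields A UNIV" "X\<^sub>3 \<in> vector_fields A UNIV"
  shows "intrinsic_curvature A g nabla D X\<^sub>1 X\<^sub>2 X\<^sub>3 p =
    orth_proj g D (curvature A nabla X\<^sub>1 X\<^sub>2 X\<^sub>3) p
    - orth_proj g D (nabla X\<^sub>1 (second_fund_form g nabla D X\<^sub>2 X\<^sub>3)) p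
    + orth_proj g D (nabla X\<^sub>2 (second_fund_form g nabla D X\<^sub>1 X\<^sub>3)) p
    + orth_proj g D (nabla (orth_proj g (orth_compl g D) (lie_bracket A X\<^sub>1 X\<^sub>2)) X\<^sub>3) p"
proof -
  define L where "L = lie_bracket A X\<^sub>1 X\<^sub>2"
  have L: "L \<in> vector_fields A UNIV"
    unfolding L_def by (intro lie_bracket_smooth assms)
  have normal: "orth_proj g (orth_compl g D) L = (\<lambda>p. L p - orth_proj g D L p)"
    by (rule ext) (rule orth_proj_orth_compl)
  have "L = (\<lambda>p. orth_proj g D L p + orth_proj g (orth_compl g D) L p)"
    by (simp add: normal)
  moreover have "orth_proj g (orth_compl g D) L \<in> vector_fields A UNIV"
    unfolding normal by (intro vector_fields_diff L orth_proj_smooth open_UNIV)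
  ultimately have "nabla L X\<^sub>3
      = (\<lambda>p. nabla (orth_proj g D L) X\<^sub>3 p + nabla (orth_proj g (orth_compl g D) L) X\<^sub>3 p)"
    using nabla_add_direction[OF connection orth_proj_smooth[OF L] _ assms(3)] by metis
  then have "orth_proj g D (nabla L X\<^sub>3) p = intrinsic_connection g nabla D (orth_proj g D L) X\<^sub>3 p
      + orth_proj g D (nabla (orth_proj g (orth_compl g D) L) X\<^sub>3) p"
    by (simp add: orth_proj_add intrinsic_connection_def)
  moreover have "orth_proj g D (curvature A nabla X\<^sub>1 X\<^sub>2 X\<^sub>3) p = orth_proj g D (nabla X\<^sub>1 (nabla X\<^sub>2 X\<^sub>3)) p
      - orth_proj g D (nabla X\<^sub>2 (nabla X\<^sub>1 X\<^sub>3)) p - orth_proj g D (nabla L X\<^sub>3) p"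
    by (simp add: curvature_def[abs_def] orth_proj_diff L_def)
  ultimately show ?thesis
    using assms by (simp add: intrinsic_curvature_def intrinsic_connection_intrinsic L_def)
qed

text \<open>The terms containing derivatives of the coefficients of \<open>N\<close> are multiples of the \<open>Z j\<close>, so the
  projection kills them.\<close>

lemma orth_proj_nabla_normal:
  assumes "X \<in> vector_fields A UNIV" "N \<in> vector_fields A UNIV" "\<And>q. N q \<in> orth_compl g D q"
    and "open U" "p \<in> U" "local_orthonormal_basis A g (orth_compl g D) U k Z"
  shows "orth_proj g D (nabla X N) p =
    (\<Sum>j=1..k. g p (N p) (Z j p) *\<^sub>R orth_proj g D (local_nabla A nabla X (Z j)) p)"
proof -
  have Z: "Z j \<in> vector_fields A U" "q \<in> U \<Longrightarrow> Z j q \<in> orth_compl g D q" if "j \<in> {1..k}" for j q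
    using assms(6) that by (auto simp: local_orthonormal_basis_def sections_def)
  have expansion: "N q = (\<Sum>j=1..k. g q (N q) (Z j q) *\<^sub>R Z j q)" if "q \<in> U" for q
    by (rule orthonormal_expansion[where F = "\<lambda>j. Z j q"])
       (use assms(3,6) that in \<open>auto simp: local_orthonormal_basis_def\<close>)
  \<comment> \<open>This repeats the choice made inside \<open>local_nabla\<close> at the point
    \<open>p\<close>, so \<open>nabla X (W j) p\<close> is
    \<open>local_nabla A nabla X (Z j) p\<close> by definition.\<close>
  define W where "W j = (SOME W. W \<in> vector_fields A UNIV \<and> (\<forall>\<^sub>F q in nhds p. W q = Z j q))" for j
  have "W j \<in> vector_fields A UNIV \<and> (\<forall>\<^sub>F q in nhds p. W j q = Z j q)" if "j \<in> {1..k}" for j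
  proof -
    have "\<exists>W. W \<in> vector_fields A UNIV \<and> (\<forall>\<^sub>F q in nhds p. W q = Z j q)"
      using vector_field_extension[OF assms(4,5) Z(1)[OF that]] by blast
    from someI_ex[OF this] show ?thesis
      unfolding W_def .
  qed
  then have W: "W j \<in> vector_fields A UNIV" "\<forall>\<^sub>F q in nhds p. W j q = Z j q" if "j \<in> {1..k}" for j
    using that by auto
  have W_p: "W j p = Z j p" if "j \<in> {1..k}" for j
    using eventually_nhds_x_imp_x[OF W(2)[OF that]] .
  \<comment> \<open>Pairing with the extension \<open>W j\<close> instead of \<open>Z j\<close>
    gives coefficients smooth on the whole manifold, as the Leibniz rule of the connection demands;
    near \<open>p\<close> they are the true coefficients of \<open>N\<close>.\<close>
  define f where "f j q = g q (N q) (W j q)" for j q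
  have f: "f j \<in> smooth_functions A UNIV" if "j \<in> {1..k}" for j
    unfolding f_def by (intro metric_smooth open_UNIV assms(2) W(1) that)
  have "\<forall>\<^sub>F q in nhds p. q \<in> U \<and> (\<forall>j\<in>{1..k}. W j q = Z j q)"
    using W(2) by (intro eventually_conj eventually_nhds_in_open assms(4,5) eventually_ball_finite) auto
  then have near: "\<forall>\<^sub>F q in nhds p. N q = (\<Sum>j=1..k. f j q *\<^sub>R W j q)"
    by eventually_elim (use expansion in \<open>simp add: f_def\<close>)
  have "nabla X N p = nabla X (\<lambda>q. \<Sum>j=1..k. f j q *\<^sub>R W j q) p"
    by (rule nabla_local[OF connection assms(1,2) _ near])
       (intro vector_fields_sum vector_fields_scaleR open_UNIV f W(1))
  also have "\<dots> = (\<Sum>j=1..k. f j p *\<^sub>R nabla X (W j) p + dir_deriv A X (f j) p *\<^sub>R W j p)"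
    by (rule nabla_sum_scaleR[OF connection assms(1) f W(1)])
  finally have "orth_proj g D (nabla X N) p =
      (\<Sum>j=1..k. f j p *\<^sub>R orth_proj g D (nabla X (W j)) p
        + dir_deriv A X (f j) p *\<^sub>R orth_proj g D (W j) p)"
    using orth_proj_cong[of "nabla X N" p
        "\<lambda>p. \<Sum>j=1..k. f j p *\<^sub>R nabla X (W j) p + dir_deriv A X (f j) p *\<^sub>R W j p"]
    by (simp add: orth_proj_sum orth_proj_add orth_proj_scaleR)
  also have "\<dots> = (\<Sum>j=1..k. g p (N p) (Z j p) *\<^sub>R orth_proj g D (local_nabla A nabla X (Z j)) p)"
  proof (rule sum.cong)
    fix j assume j: "j \<in> {1..k}"
    have "orth_proj g D (W j) p = 0"
      using Z(2)[OF j assms(5)] W_p[OF j] by (intro orth_proj_normal) simp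
    moreover have "orth_proj g D (local_nabla A nabla X (Z j)) p = orth_proj g D (nabla X (W j)) p"
      by (rule orth_proj_cong) (simp add: local_nabla_def W_def)
    ultimately show "f j p *\<^sub>R orth_proj g D (nabla X (W j)) p
        + dir_deriv A X (f j) p *\<^sub>R orth_proj g D (W j) p
        = g p (N p) (Z j p) *\<^sub>R orth_proj g D (local_nabla A nabla X (Z j)) p"
      using W_p[OF j] by (simp add: f_def)
  qed simp
  finally show ?thesis .
qed

end

theorem theorem22:
  fixes A :: "('a::{t2_space, second_countable_topology}, 'm::finite) chart set"
    and g :: "('a, 'm) metric"
    and nabla :: "('a, 'm) connection"
    and D :: "('a, 'm) distribution"
    and n :: nat
    and X\<^sub>1 X\<^sub>2 X\<^sub>3 :: "('a, 'm) vector_field"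
  assumes "smooth_atlas A"
    and "riemannian_metric A g"
    and "levi_civita A g nabla"
    and "regular_distribution A n D"
    and "X\<^sub>1 \<in> sections A D UNIV" and "X\<^sub>2 \<in> sections A D UNIV" and "X\<^sub>3 \<in> sections A D UNIV"
  shows "(\<forall>p. intrinsic_curvature A g nabla D X\<^sub>1 X\<^sub>2 X\<^sub>3 p =
            orth_proj g D (curvature A nabla X\<^sub>1 X\<^sub>2 X\<^sub>3) p
            - orth_proj g D (nabla X\<^sub>1 (second_fund_form g nabla D X\<^sub>2 X\<^sub>3)) p
            + orth_proj g D (nabla X\<^sub>2 (second_fund_form g nabla D X\<^sub>1 X\<^sub>3)) p
            + orth_proj g D (nabla (orth_proj g (orth_compl g D) (lie_bracket A X\<^sub>1 X\<^sub>2)) X\<^sub>3) p) \<and>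
         (\<forall>U Z. open U \<longrightarrow> local_orthonormal_basis A g (orth_compl g D) U (CARD('m) - n) Z \<longrightarrow>
            (\<forall>p\<in>U. intrinsic_curvature A g nabla D X\<^sub>1 X\<^sub>2 X\<^sub>3 p =
               orth_proj g D (curvature A nabla X\<^sub>1 X\<^sub>2 X\<^sub>3) p
               + (\<Sum>j=1..CARD('m) - n. second_fund_form_along g nabla D (Z j) X\<^sub>1 X\<^sub>3 p *\<^sub>R
                    orth_proj g D (local_nabla A nabla X\<^sub>2 (Z j)) p)
               - (\<Sum>j=1..CARD('m) - n. second_fund_form_along g nabla D (Z j) X\<^sub>2 X\<^sub>3 p *\<^sub>R
                    orth_proj g D (local_nabla A nabla X\<^sub>1 (Z j)) p)
               + orth_proj g D (nabla (orth_proj g (orth_compl g D) (lie_bracket A X\<^sub>1 X\<^sub>2)) X\<^sub>3) p))"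
proof -
  interpret levi_civita_distribution A g n D nabla
    using assms(1-4) by unfold_locales
  have X: "X\<^sub>1 \<in> vector_fields A UNIV" "X\<^sub>2 \<in> vector_fields A UNIV" "X\<^sub>3 \<in> vector_fields A UNIV"
    using assms(5-7) by (auto simp: sections_def)
  \<comment> \<open>The normal fields B(X_2, X_3) and B(X_1, X_3) are expanded under the derivatives
    along X_1 and X_2 respectively. The sums inherit the signs of the first identity: minus for the
    derivatives of \<open>Z j\<close> along X_1, plus for those along X_2.\<close>
  show ?thesis
    using orth_proj_nabla_normal[OF X(1) second_fund_form_smooth[OF X(2,3)] second_fund_form_normal]
      orth_proj_nabla_normal[OF X(2) second_fund_form_smooth[OF X(1,3)] second_fund_form_normal]
    by (simp add: gauss_equation[OF X] second_fund_form_along_def)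
qed

end
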